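(* Let $F$ be a field and let $P$ and $U$ be Poisson algebras over $F$ with $U$ finite dimensional. Then there exists a universal Poisson algebra of $P$ and $U$; that is, there exist a Poisson algebra $\mathcal{B}(P,U)$ over $F$ and a Poisson algebra homomorphism $\psi_{\mathcal{B}(P,U)}\colon P\to U\otimes\mathcal{B}(P,U)$ such that for every Poisson algebra $Q$ over $F$ and every Poisson algebra homomorphism $f\colon P\to U\otimes Q$ there exists a unique Poisson algebra homomorphism $g\colon \mathcal{B}(P,U)\to Q$ with $(\mathrm{id}_U\otimes g)\circ\psi_{\mathcal{B}(P,U)}=f$.
   Context: All vector spaces, algebras and tensor products are over the field $F$, and algebras are associative and unital. A Poisson algebra is a vector space $P$ carrying both a commutative associative unital algebra structure and a Lie algebra structure $[\cdot,\cdot]$ such that $[p,qr]=[p,q]\,r+q\,[p,r]$ for all $p,q,r\in P$. A morphism of Poisson algebras is a linear map that is both a (unital) algebra homomorphism and a Lie algebra homomorphism. If $P_1,P_2$ are Poisson algebras, $P_1\otimes P_2$ is a Poisson algebra with $(p\otimes q)(r\otimes s)=pr\otimes qs$ and $[p\otimes q,r\otimes s]=pr\otimes[q,s]_{P_2}+[p,r]_{P_1}\otimes qs$. *)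

theory Defs
  imports "Jordan_Normal_Form.Missing_VectorSpace"
begin

record ('f, 'a) poisson = "('f, 'a) module" +
  bracket :: "'a \<Rightarrow> 'a \<Rightarrow> 'a"  ("\<lbrace>_,/ _\<rbrace>\<index>")

text \<open>
  The locale \<^locale>\<open>algebra\<close> of HOL-Algebra already means a commutative, associative, unital
  algebra. The zero algebra is admitted. The Lie bracket is alternating, not merely
  antisymmetric, so that characteristic 2 is covered.
\<close>

locale poisson_algebra = algebra F P
  for F :: "'f ring" (structure) and P :: "('f, 'a) poisson" (structure) +
  assumes bracket_closed:
      "\<lbrakk>x \<in> carrier P; y \<in> carrier P\<rbrakk> \<Longrightarrow> \<lbrace>x, y\<rbrace>\<^bsub>P\<^esub> \<in> carrier P"
    and bracket_add_left:
      "\<lbrakk>x \<in> carrier P; y \<in> carrier P; z \<in> carrier P\<rbrakk>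
        \<Longrightarrow> \<lbrace>x \<oplus>\<^bsub>P\<^esub> y, z\<rbrace>\<^bsub>P\<^esub> = \<lbrace>x, z\<rbrace>\<^bsub>P\<^esub> \<oplus>\<^bsub>P\<^esub> \<lbrace>y, z\<rbrace>\<^bsub>P\<^esub>"
    and bracket_add_right:
      "\<lbrakk>x \<in> carrier P; y \<in> carrier P; z \<in> carrier P\<rbrakk>
        \<Longrightarrow> \<lbrace>x, y \<oplus>\<^bsub>P\<^esub> z\<rbrace>\<^bsub>P\<^esub> = \<lbrace>x, y\<rbrace>\<^bsub>P\<^esub> \<oplus>\<^bsub>P\<^esub> \<lbrace>x, z\<rbrace>\<^bsub>P\<^esub>"
    and bracket_smult_left:
      "\<lbrakk>a \<in> carrier F; x \<in> carrier P; y \<in> carrier P\<rbrakk>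
        \<Longrightarrow> \<lbrace>a \<odot>\<^bsub>P\<^esub> x, y\<rbrace>\<^bsub>P\<^esub> = a \<odot>\<^bsub>P\<^esub> \<lbrace>x, y\<rbrace>\<^bsub>P\<^esub>"
    and bracket_smult_right:
      "\<lbrakk>a \<in> carrier F; x \<in> carrier P; y \<in> carrier P\<rbrakk>
        \<Longrightarrow> \<lbrace>x, a \<odot>\<^bsub>P\<^esub> y\<rbrace>\<^bsub>P\<^esub> = a \<odot>\<^bsub>P\<^esub> \<lbrace>x, y\<rbrace>\<^bsub>P\<^esub>"
    and bracket_alternating:
      "x \<in> carrier P \<Longrightarrow> \<lbrace>x, x\<rbrace>\<^bsub>P\<^esub> = \<zero>\<^bsub>P\<^esub>"
    and jacobi:
      "\<lbrakk>x \<in> carrier P; y \<in> carrier P; z \<in> carrier P\<rbrakk>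
        \<Longrightarrow> \<lbrace>x, \<lbrace>y, z\<rbrace>\<^bsub>P\<^esub>\<rbrace>\<^bsub>P\<^esub> \<oplus>\<^bsub>P\<^esub> \<lbrace>y, \<lbrace>z, x\<rbrace>\<^bsub>P\<^esub>\<rbrace>\<^bsub>P\<^esub> \<oplus>\<^bsub>P\<^esub> \<lbrace>z, \<lbrace>x, y\<rbrace>\<^bsub>P\<^esub>\<rbrace>\<^bsub>P\<^esub> = \<zero>\<^bsub>P\<^esub>"
    and leibniz:
      "\<lbrakk>x \<in> carrier P; y \<in> carrier P; z \<in> carrier P\<rbrakk>
        \<Longrightarrow> \<lbrace>x, y \<otimes>\<^bsub>P\<^esub> z\<rbrace>\<^bsub>P\<^esub> = \<lbrace>x, y\<rbrace>\<^bsub>P\<^esub> \<otimes>\<^bsub>P\<^esub> z \<oplus>\<^bsub>P\<^esub> y \<otimes>\<^bsub>P\<^esub> \<lbrace>x, z\<rbrace>\<^bsub>P\<^esub>"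

definition poisson_hom ::
  "'f ring \<Rightarrow> ('f, 'a) poisson \<Rightarrow> ('f, 'b) poisson \<Rightarrow> ('a \<Rightarrow> 'b) set" where
  "poisson_hom F P Q = {h \<in> ring_hom P Q \<inter> module_hom F P Q.
     \<forall>x\<in>carrier P. \<forall>y\<in>carrier P. h \<lbrace>x, y\<rbrace>\<^bsub>P\<^esub> = \<lbrace>h x, h y\<rbrace>\<^bsub>Q\<^esub>}"

text \<open>
  The tensor product \<open>U \<otimes> V\<close> over \<open>F\<close>. A finite multiset \<open>{#(u\<^sub>1,v\<^sub>1), \<dots>, (u\<^sub>n,v\<^sub>n)#}\<close> stands for the
  formal sum \<open>u\<^sub>1 \<otimes> v\<^sub>1 + \<dots> + u\<^sub>n \<otimes> v\<^sub>n\<close>; scalars need not be recorded separately since they can be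
  absorbed in the first factor. The relation below is the additive congruence on formal sums
  generated by bilinearity. Formal sums form only a monoid, in which bilinearity alone does not
  identify \<open>0 \<otimes> v\<close> with the empty sum, hence the rule \<open>zero\<close>; negatives then exist because
  \<open>u \<otimes> v + (- u) \<otimes> v = 0 \<otimes> v\<close>.
\<close>

definition formal_sums ::
  "('f, 'u, 'm) module_scheme \<Rightarrow> ('f, 'v, 'n) module_scheme \<Rightarrow> ('u \<times> 'v) multiset set" where
  "formal_sums U V = {M. set_mset M \<subseteq> carrier U \<times> carrier V}"

inductive tensor_eq ::
  "'f ring \<Rightarrow> ('f, 'u, 'm) module_scheme \<Rightarrow> ('f, 'v, 'n) module_scheme
    \<Rightarrow> ('u \<times> 'v) multiset \<Rightarrow> ('u \<times> 'v) multiset \<Rightarrow> bool"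
  for F U V where
  refl: "M \<in> formal_sums U V \<Longrightarrow> tensor_eq F U V M M"
| sym: "tensor_eq F U V M N \<Longrightarrow> tensor_eq F U V N M"
| trans: "tensor_eq F U V L M \<Longrightarrow> tensor_eq F U V M N \<Longrightarrow> tensor_eq F U V L N"
| plus: "tensor_eq F U V M M' \<Longrightarrow> N \<in> formal_sums U V \<Longrightarrow> tensor_eq F U V (M + N) (M' + N)"
| zero: "v \<in> carrier V \<Longrightarrow> tensor_eq F U V {#(\<zero>\<^bsub>U\<^esub>, v)#} {#}"
| add_left: "\<lbrakk>u \<in> carrier U; u' \<in> carrier U; v \<in> carrier V\<rbrakk>
    \<Longrightarrow> tensor_eq F U V {#(u \<oplus>\<^bsub>U\<^esub> u', v)#} {#(u, v), (u', v)#}"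
| add_right: "\<lbrakk>u \<in> carrier U; v \<in> carrier V; v' \<in> carrier V\<rbrakk>
    \<Longrightarrow> tensor_eq F U V {#(u, v \<oplus>\<^bsub>V\<^esub> v')#} {#(u, v), (u, v')#}"
| smult: "\<lbrakk>a \<in> carrier F; u \<in> carrier U; v \<in> carrier V\<rbrakk>
    \<Longrightarrow> tensor_eq F U V {#(a \<odot>\<^bsub>U\<^esub> u, v)#} {#(u, a \<odot>\<^bsub>V\<^esub> v)#}"

definition tensor_class ::
  "'f ring \<Rightarrow> ('f, 'u, 'm) module_scheme \<Rightarrow> ('f, 'v, 'n) module_scheme
    \<Rightarrow> ('u \<times> 'v) multiset \<Rightarrow> ('u \<times> 'v) multiset set" where
  "tensor_class F U V M = {N. tensor_eq F U V M N}"

text \<open>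
  Operations on classes are given by the union over all representatives, as in
  \<open>rcoset_mult\<close> of HOL-Algebra; every representative yields the same class. The product and the bracket are
  the bilinear extensions of \<open>(p \<otimes> q) (r \<otimes> s) = pr \<otimes> qs\<close> and
  \<open>[p \<otimes> q, r \<otimes> s] = pr \<otimes> [q, s] + [p, r] \<otimes> qs\<close>.
\<close>

definition tensor_product ::
  "'f ring \<Rightarrow> ('f, 'u) poisson \<Rightarrow> ('f, 'v) poisson \<Rightarrow> ('f, ('u \<times> 'v) multiset set) poisson" where
  "tensor_product F U V =
    \<lparr> carrier = tensor_class F U V ` formal_sums U V,
      mult = (\<lambda>X Y. \<Union>M\<in>X. \<Union>N\<in>Y. tensor_class F U V
        (\<Sum>(p, q)\<in>#M. \<Sum>(r, s)\<in>#N. {#(p \<otimes>\<^bsub>U\<^esub> r, q \<otimes>\<^bsub>V\<^esub> s)#})),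
      one = tensor_class F U V {#(\<one>\<^bsub>U\<^esub>, \<one>\<^bsub>V\<^esub>)#},
      zero = tensor_class F U V {#},
      add = (\<lambda>X Y. \<Union>M\<in>X. \<Union>N\<in>Y. tensor_class F U V (M + N)),
      smult = (\<lambda>a X. \<Union>M\<in>X. tensor_class F U V {#(a \<odot>\<^bsub>U\<^esub> u, v). (u, v) \<in># M#}),
      bracket = (\<lambda>X Y. \<Union>M\<in>X. \<Union>N\<in>Y. tensor_class F U V
        (\<Sum>(p, q)\<in>#M. \<Sum>(r, s)\<in>#N.
          {#(p \<otimes>\<^bsub>U\<^esub> r, \<lbrace>q, s\<rbrace>\<^bsub>V\<^esub>), (\<lbrace>p, r\<rbrace>\<^bsub>U\<^esub>, q \<otimes>\<^bsub>V\<^esub> s)#})) \<rparr>"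

text \<open>The map \<open>id\<^sub>U \<otimes> g\<close> from \<open>U \<otimes> V\<close> to \<open>U \<otimes> W\<close>, for linear \<open>g\<close> from \<open>V\<close> to \<open>W\<close>.\<close>

definition id_tensor ::
  "'f ring \<Rightarrow> ('f, 'u) poisson \<Rightarrow> ('f, 'w) poisson \<Rightarrow> ('v \<Rightarrow> 'w)
    \<Rightarrow> ('u \<times> 'v) multiset set \<Rightarrow> ('u \<times> 'w) multiset set" where
  "id_tensor F U W g X = (\<Union>M\<in>X. tensor_class F U W {#(u, g v). (u, v) \<in># M#})"

text \<open>
  \<open>(B, \<psi>)\<close> is universal among the Poisson algebras whose carrier is a set of elements of the
  type \<open>'q\<close>. Maps matter on the carrier only; uniqueness of \<open>g\<close> is therefore taken among functions
  that are \<^const>\<open>undefined\<close> outside the carrier of \<open>B\<close>.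
\<close>

definition universal_poisson_algebra_for ::
  "'q itself \<Rightarrow> 'f ring \<Rightarrow> ('f, 'p) poisson \<Rightarrow> ('f, 'u) poisson
    \<Rightarrow> ('f, 'b) poisson \<Rightarrow> ('p \<Rightarrow> ('u \<times> 'b) multiset set) \<Rightarrow> bool" where
  "universal_poisson_algebra_for (_ :: 'q itself) F P U B \<psi> \<longleftrightarrow>
     poisson_algebra F B \<and>
     \<psi> \<in> poisson_hom F P (tensor_product F U B) \<and>
     (\<forall>(Q :: ('f, 'q) poisson) f.
        poisson_algebra F Q \<longrightarrow>
        f \<in> poisson_hom F P (tensor_product F U Q) \<longrightarrow>
        (\<exists>!g. g \<in> poisson_hom F B Q \<and> g \<in> extensional (carrier B) \<and>
              (\<forall>p\<in>carrier P. id_tensor F U Q g (\<psi> p) = f p)))"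

text \<open>
  The type of formal Poisson expressions in generators indexed by pairs. It serves only to
  provide a type in which a universal Poisson algebra can be found: the type has no operations
  or relations attached, and all that matters about it is that sets of expressions are numerous
  enough to be the elements of any Poisson algebra generated by elements indexed by
  \<open>'u \<times> 'p\<close> over a field in \<open>'f\<close>.
\<close>

datatype ('f, 'p, 'u) poisson_term =
    Gen 'u 'p
  | One
  | Add "('f, 'p, 'u) poisson_term" "('f, 'p, 'u) poisson_term"
  | Smult 'f "('f, 'p, 'u) poisson_term"
  | Mult "('f, 'p, 'u) poisson_term" "('f, 'p, 'u) poisson_term"
  | Bracket "('f, 'p, 'u) poisson_term" "('f, 'p, 'u) poisson_term"

text \<open>
  HOL cannot quantify over types inside a formula, so "there is \<open>(B, \<psi>)\<close> such that for every \<open>Q\<close>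
  of every type" has to be split: there is a pair \<open>(B, \<psi>)\<close> that is universal for all \<open>Q\<close> in the
  fixed type \<open>('f, 'p, 'u) poisson_term set\<close>, and every such pair is universal for all \<open>Q\<close> in an
  arbitrary type \<open>'q\<close>. As \<open>'q\<close> does not occur in the first part, \<open>(B, \<psi>)\<close> does not depend on it.
\<close>

abbreviation universal_poisson_algebra ::
  "'f ring \<Rightarrow> ('f, 'p) poisson \<Rightarrow> ('f, 'u) poisson \<Rightarrow> ('f, ('f, 'p, 'u) poisson_term set) poisson
    \<Rightarrow> ('p \<Rightarrow> ('u \<times> ('f, 'p, 'u) poisson_term set) multiset set) \<Rightarrow> bool" where
  "universal_poisson_algebra \<equiv>
     universal_poisson_algebra_for TYPE(('f, 'p, 'u) poisson_term set)"

end

theory Submission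
  imports Defs
begin

text \<open>
  Fix a basis \<open>E\<close> of \<open>U\<close>. Every element of \<open>U \<otimes> Q\<close> is \<open>\<Sum> e \<otimes> x\<^sub>e\<close> for unique coordinates \<open>x\<^sub>e\<close> in \<open>Q\<close>, so
  a map \<open>f\<close> from \<open>P\<close> to \<open>U \<otimes> Q\<close> is the same thing as a family of coefficients \<open>f\<^sub>e p\<close> in \<open>Q\<close>. The
  finiteness of \<open>E\<close> is what makes every such family come from a map into the tensor product. That
  \<open>f\<close> is a Poisson homomorphism says that its coefficients satisfy certain polynomial identities
  in which the bracket may occur; the universal algebra \<open>B\<close> is the one generated by symbols
  \<open>x\<^sub>e p\<close> subject to these identities.

  The identities involve the structure constants of \<open>U\<close>, and the proof never writes them down.
  Take the Poisson expressions in the symbols \<open>x\<^sub>e p\<close> and identify two of them when, for all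
  homomorphisms \<open>f\<close> into \<open>U \<otimes> Q\<close>, with \<open>Q\<close> ranging over the Poisson algebras whose elements are
  sets of such expressions, they have the same value in \<open>Q\<close> after substituting \<open>f\<^sub>e p\<close> for \<open>x\<^sub>e p\<close>. The quotient \<open>B\<close> embeds in the product of all these \<open>Q\<close>, so it is
  a Poisson algebra (\<open>poisson_algebra_jointly_embedded\<close>). The map \<open>\<psi> p = \<Sum> e \<otimes> x\<^sub>e p\<close> is a
  homomorphism because it becomes one after applying any of the maps \<open>id \<otimes> \<pi>\<close>, where \<open>\<pi>\<close> runs
  through the projections from \<open>B\<close> to the algebras \<open>Q\<close>, and these maps are homomorphisms
  that are jointly injective on \<open>U \<otimes> B\<close> (\<open>generic_hom_hom\<close>). The factorisation of \<open>f\<close> through \<open>\<psi>\<close> is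
  the projection belonging to \<open>f\<close>. It is unique because the coefficients of \<open>\<psi>\<close> generate
  \<open>B\<close> and a factorisation has to send \<open>x\<^sub>e p\<close> to \<open>f\<^sub>e p\<close> (\<open>hom_unique\<close>).

  The construction is carried out for an arbitrary set \<open>H\<close> of pairs \<open>(Q, f)\<close> in place of all
  of them. For the set \<open>{(Q, f)}\<close> it yields an isomorphic copy of the subalgebra of \<open>Q\<close> generated by
  the coefficients of \<open>f\<close>, and the elements of this copy are sets of expressions whatever the
  type of \<open>Q\<close> is. A pair \<open>(B, \<psi>)\<close> that is universal for algebras of sets of expressions therefore
  factors every homomorphism into any \<open>U \<otimes> Q\<close>. Applied to \<open>(B, \<psi>)\<close> itself, the same argument shows
  that every element of \<open>B\<close> is the value of an expression in the coefficients of \<open>\<psi>\<close>, which gives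
  uniqueness.
\<close>

section \<open>Operations on the tensor product\<close>

lemma formal_sums_empty [simp]: "{#} \<in> formal_sums U V"
  by (simp add: formal_sums_def)

lemma formal_sums_add_mset [simp]:
  "add_mset (u, v) M \<in> formal_sums U V \<longleftrightarrow>
     u \<in> carrier U \<and> v \<in> carrier V \<and> M \<in> formal_sums U V"
  by (auto simp: formal_sums_def)

lemma formal_sums_union [simp]:
  "M + N \<in> formal_sums U V \<longleftrightarrow> M \<in> formal_sums U V \<and> N \<in> formal_sums U V"
  by (auto simp: formal_sums_def)

lemma formal_sums_sum:
  "(\<And>x. x \<in># N \<Longrightarrow> f x \<in> formal_sums U V) \<Longrightarrow> (\<Sum>x\<in>#N. f x) \<in> formal_sums U V"
  by (induction N) auto

lemma formal_sums_image:
  "(\<And>x. x \<in># N \<Longrightarrow> f x \<in> carrier U \<times> carrier V) \<Longrightarrow> {#f x. x \<in># N#} \<in> formal_sums U V"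
  unfolding formal_sums_def by fastforce

lemma formal_sumsD:
  assumes "M \<in> formal_sums U V" "(u, v) \<in># M"
  shows "u \<in> carrier U" "v \<in> carrier V"
  using assms by (auto simp: formal_sums_def)

definition bilinear_op ::
  "'f ring \<Rightarrow> ('f, 'a, 'm) module_scheme \<Rightarrow> ('a \<Rightarrow> 'a \<Rightarrow> 'a) \<Rightarrow> bool" where
  "bilinear_op F U A \<longleftrightarrow>
     (\<forall>x\<in>carrier U. \<forall>y\<in>carrier U. A x y \<in> carrier U) \<and>
     (\<forall>x\<in>carrier U. \<forall>y\<in>carrier U. \<forall>z\<in>carrier U. A (x \<oplus>\<^bsub>U\<^esub> y) z = A x z \<oplus>\<^bsub>U\<^esub> A y z) \<and>
     (\<forall>x\<in>carrier U. \<forall>y\<in>carrier U. \<forall>z\<in>carrier U. A x (y \<oplus>\<^bsub>U\<^esub> z) = A x y \<oplus>\<^bsub>U\<^esub> A x z) \<and>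
     (\<forall>a\<in>carrier F. \<forall>x\<in>carrier U. \<forall>y\<in>carrier U. A (a \<odot>\<^bsub>U\<^esub> x) y = a \<odot>\<^bsub>U\<^esub> A x y) \<and>
     (\<forall>a\<in>carrier F. \<forall>x\<in>carrier U. \<forall>y\<in>carrier U. A x (a \<odot>\<^bsub>U\<^esub> y) = a \<odot>\<^bsub>U\<^esub> A x y)"

lemma bilinear_op_closed:
  "bilinear_op F U A \<Longrightarrow> x \<in> carrier U \<Longrightarrow> y \<in> carrier U \<Longrightarrow> A x y \<in> carrier U"
  by (simp add: bilinear_op_def)

lemma bilinear_op_distrib:
  assumes "bilinear_op F U A" "x \<in> carrier U" "y \<in> carrier U"
  shows "z \<in> carrier U \<Longrightarrow> A (x \<oplus>\<^bsub>U\<^esub> y) z = A x z \<oplus>\<^bsub>U\<^esub> A y z"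
    and "z \<in> carrier U \<Longrightarrow> A z (x \<oplus>\<^bsub>U\<^esub> y) = A z x \<oplus>\<^bsub>U\<^esub> A z y"
    and "a \<in> carrier F \<Longrightarrow> A (a \<odot>\<^bsub>U\<^esub> x) y = a \<odot>\<^bsub>U\<^esub> A x y"
    and "a \<in> carrier F \<Longrightarrow> A x (a \<odot>\<^bsub>U\<^esub> y) = a \<odot>\<^bsub>U\<^esub> A x y"
  using assms by (simp_all add: bilinear_op_def)

lemma bilinear_op_swap: "bilinear_op F U A \<Longrightarrow> bilinear_op F U (\<lambda>x y. A y x)"
  by (auto simp: bilinear_op_def)

lemma bilinear_op_zero_left:
  assumes "module F U" "bilinear_op F U A" "x \<in> carrier U"
  shows "A \<zero>\<^bsub>U\<^esub> x = \<zero>\<^bsub>U\<^esub>"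
proof -
  interpret U: module F U by fact
  have "A \<zero>\<^bsub>U\<^esub> x = A (\<zero>\<^bsub>F\<^esub> \<odot>\<^bsub>U\<^esub> \<zero>\<^bsub>U\<^esub>) x" by simp
  also have "\<dots> = \<zero>\<^bsub>F\<^esub> \<odot>\<^bsub>U\<^esub> A \<zero>\<^bsub>U\<^esub> x" 
    using assms(2,3) U.R.zero_closed U.M.zero_closed unfolding bilinear_op_def by blast
  also have "\<dots> = \<zero>\<^bsub>U\<^esub>" using assms(2,3) by (simp add: bilinear_op_def)
  finally show ?thesis .
qed

text \<open>
  The product of \<open>U \<otimes> V\<close> is the case of the two products, and the bracket is the sum of the cases
  product/bracket and bracket/product; well-definedness is needed only for this common form.
\<close>

definition bilinear_extension ::
  "('u \<Rightarrow> 'u \<Rightarrow> 'u) \<Rightarrow> ('v \<Rightarrow> 'v \<Rightarrow> 'v) \<Rightarrow> ('u \<times> 'v) multiset \<Rightarrow> ('u \<times> 'v) multiset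
    \<Rightarrow> ('u \<times> 'v) multiset" where
  "bilinear_extension A B M N = (\<Sum>(p, q)\<in>#M. \<Sum>(r, s)\<in>#N. {#(A p r, B q s)#})"

lemma bilinear_extension_simps [simp]:
  "bilinear_extension A B {#} N = {#}"
  "bilinear_extension A B (add_mset (p, q) M) N =
     (\<Sum>(r, s)\<in>#N. {#(A p r, B q s)#}) + bilinear_extension A B M N"
  "bilinear_extension A B (M + M') N = bilinear_extension A B M N + bilinear_extension A B M' N"
  by (simp_all add: bilinear_extension_def)

lemma bilinear_extension_swap:
  "bilinear_extension A B M N = bilinear_extension (\<lambda>x y. A y x) (\<lambda>x y. B y x) N M"
  unfolding bilinear_extension_def case_prod_beta by (rule sum_mset.swap)

locale tensor = U: module F U + V: module F V
  for F :: "'f ring" and U :: "('f, 'u, 'm) module_scheme" and V :: "('f, 'v, 'n) module_scheme"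
begin

abbreviation eq (infix "\<approx>" 50) where "M \<approx> N \<equiv> tensor_eq F U V M N"
abbreviation formal where "formal \<equiv> formal_sums U V"
abbreviation cls where "cls \<equiv> tensor_class F U V"

lemma tensor_eq_formal: "M \<approx> N \<Longrightarrow> M \<in> formal \<and> N \<in> formal"
  by (induction rule: tensor_eq.induct) auto

lemma tensor_eq_union:
  assumes "M \<approx> M'" "N \<approx> N'"
  shows "M + N \<approx> M' + N'"
proof -
  have "M + N \<approx> M' + N"
    using assms tensor_eq_formal by (blast intro: tensor_eq.plus)
  moreover have "N + M' \<approx> N' + M'"
    using assms tensor_eq_formal by (blast intro: tensor_eq.plus)
  ultimately show ?thesis
    by (metis add.commute tensor_eq.trans)
qed

lemma tensor_eq_sum:
  "(\<And>x. x \<in># N \<Longrightarrow> f x \<approx> g x) \<Longrightarrow> (\<Sum>x\<in>#N. f x) \<approx> (\<Sum>x\<in>#N. g x)"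
  by (induction N) (auto intro: tensor_eq.refl tensor_eq_union)

lemma tensor_class_eq_iff:
  "M \<in> formal \<Longrightarrow> cls M = cls N \<longleftrightarrow> M \<approx> N"
  unfolding tensor_class_def by (blast intro: tensor_eq.intros)

lemma in_tensor_class: "M \<in> formal \<Longrightarrow> M \<in> cls M"
  by (simp add: tensor_class_def tensor_eq.refl)

lemma bilinear_extension_formal:
  assumes "bilinear_op F U A" "bilinear_op F V B" "M \<in> formal" "N \<in> formal"
  shows "bilinear_extension A B M N \<in> formal"
  unfolding bilinear_extension_def
  by (auto intro!: formal_sums_sum bilinear_op_closed[OF assms(1)] bilinear_op_closed[OF assms(2)]
      intro: formal_sumsD[OF assms(3)] formal_sumsD[OF assms(4)])

text \<open>
  With \<open>N\<close> and one summand \<open>p \<otimes> q\<close> fixed, \<open>r \<otimes> s \<mapsto> A p r \<otimes> B q s\<close> is bilinear in \<open>(p, q)\<close>, so each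
  generating relation between the first arguments maps to a sum of relations of the same kind.
  The second argument reduces to the first by exchanging the roles of the two.
\<close>

lemma bilinear_extension_cong_left:
  assumes A: "bilinear_op F U A" and B: "bilinear_op F V B" and N: "N \<in> formal"
  shows "M \<approx> M' \<Longrightarrow> bilinear_extension A B M N \<approx> bilinear_extension A B M' N"
proof (induction rule: tensor_eq.induct)
  case (refl M)
  then show ?case by (intro tensor_eq.refl bilinear_extension_formal A B N)
next
  case (sym M N)
  show ?case by (rule tensor_eq.sym) (rule sym.IH)
next
  case (trans L M N)
  then show ?case by (blast intro: tensor_eq.trans)
next
  case (plus M M' K)
  then show ?case
    by (auto intro!: tensor_eq_union intro: tensor_eq.refl bilinear_extension_formal A B N)
next
  case (zero v)
  have "(\<Sum>(r, s)\<in>#N. {#(A \<zero>\<^bsub>U\<^esub> r, B v s)#}) \<approx> (\<Sum>x\<in>#N. {#})"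
    using zero
    by (intro tensor_eq_sum) (auto intro!: tensor_eq.zero bilinear_op_closed[OF B]
        intro: formal_sumsD[OF N]
        simp: bilinear_op_zero_left[OF U.module_axioms A formal_sumsD(1)[OF N]])
  then show ?case by simp
next
  case (add_left u u' v)
  have "(\<Sum>(r, s)\<in>#N. {#(A (u \<oplus>\<^bsub>U\<^esub> u') r, B v s)#}) \<approx>
        (\<Sum>(r, s)\<in>#N. {#(A u r, B v s)#} + {#(A u' r, B v s)#})"
  proof (rule tensor_eq_sum, clarify)
    fix r s assume "(r, s) \<in># N"
    then have "r \<in> carrier U" "s \<in> carrier V" using formal_sumsD[OF N] by auto
    then have "{#(A (u \<oplus>\<^bsub>U\<^esub> u') r, B v s)#} \<approx> {#(A u r, B v s), (A u' r, B v s)#}"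
      using add_left by (simp add: bilinear_op_distrib[OF A] bilinear_op_closed[OF A]
          bilinear_op_closed[OF B] tensor_eq.add_left)
    then show "{#(A (u \<oplus>\<^bsub>U\<^esub> u') r, B v s)#} \<approx> {#(A u r, B v s)#} + {#(A u' r, B v s)#}"
      by (simp add: add_mset_commute)
  qed
  then show ?case by (simp only: case_prod_unfold sum_mset.distrib) (simp add: case_prod_unfold)
next
  case (add_right u v v')
  have "(\<Sum>(r, s)\<in>#N. {#(A u r, B (v \<oplus>\<^bsub>V\<^esub> v') s)#}) \<approx>
        (\<Sum>(r, s)\<in>#N. {#(A u r, B v s)#} + {#(A u r, B v' s)#})"
  proof (rule tensor_eq_sum, clarify)
    fix r s assume "(r, s) \<in># N"
    then have "r \<in> carrier U" "s \<in> carrier V" using formal_sumsD[OF N] by auto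
    then have "{#(A u r, B (v \<oplus>\<^bsub>V\<^esub> v') s)#} \<approx> {#(A u r, B v s), (A u r, B v' s)#}"
      using add_right by (simp add: bilinear_op_distrib[OF B] bilinear_op_closed[OF A]
          bilinear_op_closed[OF B] tensor_eq.add_right)
    then show "{#(A u r, B (v \<oplus>\<^bsub>V\<^esub> v') s)#} \<approx> {#(A u r, B v s)#} + {#(A u r, B v' s)#}"
      by (simp add: add_mset_commute)
  qed
  then show ?case by (simp only: case_prod_unfold sum_mset.distrib) (simp add: case_prod_unfold)
next
  case (smult a u v)
  have "(\<Sum>(r, s)\<in>#N. {#(A (a \<odot>\<^bsub>U\<^esub> u) r, B v s)#}) \<approx>
        (\<Sum>(r, s)\<in>#N. {#(A u r, B (a \<odot>\<^bsub>V\<^esub> v) s)#})"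
    using smult
    by (intro tensor_eq_sum)
      (auto simp: bilinear_op_distrib[OF A] bilinear_op_distrib[OF B]
        formal_sumsD[OF N] bilinear_op_closed[OF A] bilinear_op_closed[OF B]
        intro!: tensor_eq.smult bilinear_op_closed[OF A] bilinear_op_closed[OF B]
        intro: formal_sumsD[OF N])
  then show ?case by simp
qed

lemma bilinear_extension_cong:
  assumes "bilinear_op F U A" "bilinear_op F V B" "M \<approx> M'" "N \<approx> N'"
  shows "bilinear_extension A B M N \<approx> bilinear_extension A B M' N'"
proof -
  have "bilinear_extension A B M N \<approx> bilinear_extension A B M' N"
    using assms tensor_eq_formal by (blast intro: bilinear_extension_cong_left)
  moreover have "bilinear_extension A B M' N \<approx> bilinear_extension A B M' N'"
    using assms tensor_eq_formal
      bilinear_extension_cong_left[OF bilinear_op_swap[OF assms(1)] bilinear_op_swap[OF assms(2)]]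
    by (subst (1 2) bilinear_extension_swap) blast
  ultimately show ?thesis by (rule tensor_eq.trans)
qed

text \<open>
  The operations on classes are unions over all representatives; once an operation respects the
  congruence, all members of the union coincide and any one representative computes it.
\<close>

lemma tensor_class_binary_op:
  assumes "\<And>M M' N N'. M \<approx> M' \<Longrightarrow> N \<approx> N' \<Longrightarrow> f M N \<approx> f M' N'" "M \<in> formal" "N \<in> formal"
  shows "(\<Union>M'\<in>cls M. \<Union>N'\<in>cls N. cls (f M' N')) = cls (f M N)"
proof -
  have "cls (f M' N') = cls (f M N)" if "M' \<in> cls M" "N' \<in> cls N" for M' N'
    using that assms(1)[of M M' N N'] tensor_eq_formal
    by (metis tensor_class_def mem_Collect_eq tensor_class_eq_iff)
  then show ?thesis using in_tensor_class assms(2,3) by blast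
qed

lemma tensor_class_unary_op:
  assumes "\<And>M M'. M \<approx> M' \<Longrightarrow> tensor_eq F U W (f M) (f M')" "M \<in> formal"
  shows "(\<Union>M'\<in>cls M. tensor_class F U W (f M')) = tensor_class F U W (f M)"
proof -
  have "tensor_class F U W (f M') = tensor_class F U W (f M)" if "M' \<in> cls M" for M'
    using that assms(1)[of M M']
    unfolding tensor_class_def by (blast intro: tensor_eq.intros)
  then show ?thesis using in_tensor_class assms(2) by blast
qed

lemma tensor_eq_map_smult:
  assumes a: "a \<in> carrier F"
  shows "M \<approx> M' \<Longrightarrow> {#(a \<odot>\<^bsub>U\<^esub> u, v). (u, v) \<in># M#} \<approx> {#(a \<odot>\<^bsub>U\<^esub> u, v). (u, v) \<in># M'#}"
proof (induction rule: tensor_eq.induct)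
  case (refl M)
  then show ?case using a
    by (auto intro!: tensor_eq.refl formal_sums_image dest: formal_sumsD)
next
  case (sym M N)
  show ?case by (rule tensor_eq.sym) (rule sym.IH)
next
  case (trans L M N)
  then show ?case by (blast intro: tensor_eq.trans)
next
  case (plus M M' K)
  then show ?case using a
    by (auto intro!: tensor_eq_union tensor_eq.refl formal_sums_image dest: formal_sumsD)
next
  case (zero v)
  then show ?case using a by (simp add: tensor_eq.zero)
next
  case (add_left u u' v)
  then show ?case using a by (simp add: U.smult_r_distr tensor_eq.add_left)
next
  case (add_right u v v')
  then show ?case using a by (simp add: tensor_eq.add_right)
next
  case (smult b u v)
  then show ?case using a tensor_eq.smult[of b F "a \<odot>\<^bsub>U\<^esub> u" U v V]
    by (simp add: U.smult_assoc1[symmetric] U.R.m_comm)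
qed

lemma tensor_eq_map:
  assumes g: "g \<in> module_hom F V W"
  shows "M \<approx> M' \<Longrightarrow> tensor_eq F U W {#(u, g v). (u, v) \<in># M#} {#(u, g v). (u, v) \<in># M'#}"
proof (induction rule: tensor_eq.induct)
  case (refl M)
  then show ?case using g
    by (auto intro!: tensor_eq.refl formal_sums_image simp: module_hom_def dest: formal_sumsD)
next
  case (sym M N)
  show ?case by (rule tensor_eq.sym) (rule sym.IH)
next
  case (trans L M N)
  then show ?case by (blast intro: tensor_eq.trans)
next
  case (plus M M' K)
  then have "{#(u, g v). (u, v) \<in># K#} \<in> formal_sums U W" using g
    by (auto intro!: formal_sums_image simp: module_hom_def dest: formal_sumsD)
  then show ?case using tensor_eq.plus[OF plus.IH] by simp
next
  case (zero v)
  then show ?case using g by (auto simp: module_hom_def intro: tensor_eq.zero)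
next
  case (add_left u u' v)
  then show ?case using g by (auto simp: module_hom_def intro!: tensor_eq.add_left)
next
  case (add_right u v v')
  then show ?case using g by (auto simp: module_hom_def intro!: tensor_eq.add_right)
next
  case (smult b u v)
  then show ?case using g by (auto simp: module_hom_def intro!: tensor_eq.smult)
qed

end

lemma (in poisson_algebra) bilinear_op_mult: "bilinear_op F P (\<otimes>\<^bsub>P\<^esub>)"
proof -
  have "x \<otimes>\<^bsub>P\<^esub> (a \<odot>\<^bsub>P\<^esub> y) = a \<odot>\<^bsub>P\<^esub> (x \<otimes>\<^bsub>P\<^esub> y)"
    if "a \<in> carrier F" "x \<in> carrier P" "y \<in> carrier P" for a x y
    using that by (metis smult_assoc2 m_comm smult_closed)
  then show ?thesis
    unfolding bilinear_op_def by (simp add: l_distr r_distr smult_assoc2)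
qed

lemma (in poisson_algebra) bilinear_op_bracket: "bilinear_op F P (bracket P)"
  unfolding bilinear_op_def
  by (simp add: bracket_closed bracket_add_left bracket_add_right
      bracket_smult_left bracket_smult_right)

locale tensor_poisson = U: poisson_algebra F U + V: poisson_algebra F V
  for F :: "'f ring" and U :: "('f, 'u) poisson" and V :: "('f, 'v) poisson"
begin

sublocale tensor F U V ..

abbreviation UV where "UV \<equiv> tensor_product F U V"

abbreviation mult_sum where
  "mult_sum \<equiv> bilinear_extension (\<otimes>\<^bsub>U\<^esub>) (\<otimes>\<^bsub>V\<^esub>)"

abbreviation bracket_sum where
  "bracket_sum M N \<equiv> bilinear_extension (\<otimes>\<^bsub>U\<^esub>) (bracket V) M N +
     bilinear_extension (bracket U) (\<otimes>\<^bsub>V\<^esub>) M N"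

lemma bracket_sum_eq:
  "bracket_sum M N = (\<Sum>(p, q)\<in>#M. \<Sum>(r, s)\<in>#N.
     {#(p \<otimes>\<^bsub>U\<^esub> r, \<lbrace>q, s\<rbrace>\<^bsub>V\<^esub>), (\<lbrace>p, r\<rbrace>\<^bsub>U\<^esub>, q \<otimes>\<^bsub>V\<^esub> s)#})"
proof -
  have *: "{#x, y#} = {#x#} + {#y#}" for x y :: "'u \<times> 'v"
    by (simp add: add_mset_commute)
  show ?thesis
    unfolding bilinear_extension_def * case_prod_beta by (simp only: sum_mset.distrib)
qed

lemmas bilinear_ops = U.bilinear_op_mult V.bilinear_op_mult
  U.bilinear_op_bracket V.bilinear_op_bracket

lemma tensor_product_carrier: "carrier UV = cls ` formal"
  by (simp add: tensor_product_def)

lemma tensor_product_class: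
  assumes "M \<in> formal" "N \<in> formal"
  shows "cls M \<oplus>\<^bsub>UV\<^esub> cls N = cls (M + N)"
    and "cls M \<otimes>\<^bsub>UV\<^esub> cls N = cls (mult_sum M N)"
    and "\<lbrace>cls M, cls N\<rbrace>\<^bsub>UV\<^esub> = cls (bracket_sum M N)"
    and "a \<in> carrier F \<Longrightarrow> a \<odot>\<^bsub>UV\<^esub> cls M = cls {#(a \<odot>\<^bsub>U\<^esub> u, v). (u, v) \<in># M#}"
proof -
  show "cls M \<oplus>\<^bsub>UV\<^esub> cls N = cls (M + N)"
    using tensor_class_binary_op[of "(+)", OF tensor_eq_union assms]
    by (simp add: tensor_product_def)
  show "cls M \<otimes>\<^bsub>UV\<^esub> cls N = cls (mult_sum M N)"
    using tensor_class_binary_op[of mult_sum, OF bilinear_extension_cong assms] bilinear_ops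
    by (simp add: tensor_product_def bilinear_extension_def)
  show "\<lbrace>cls M, cls N\<rbrace>\<^bsub>UV\<^esub> = cls (bracket_sum M N)"
    using tensor_class_binary_op[of bracket_sum, OF _ assms] bilinear_ops
    unfolding bracket_sum_eq[symmetric] tensor_product_def
    by (simp add: bracket_sum_eq[symmetric] tensor_eq_union bilinear_extension_cong)
  show "a \<odot>\<^bsub>UV\<^esub> cls M = cls {#(a \<odot>\<^bsub>U\<^esub> u, v). (u, v) \<in># M#}" if "a \<in> carrier F"
    using tensor_class_unary_op[OF tensor_eq_map_smult[OF that] assms(1)]
    by (simp add: tensor_product_def)
qed

lemma tensor_product_one: "\<one>\<^bsub>UV\<^esub> = cls {#(\<one>\<^bsub>U\<^esub>, \<one>\<^bsub>V\<^esub>)#}"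
  by (simp add: tensor_product_def)

lemma sums_formal:
  assumes "M \<in> formal" "N \<in> formal"
  shows "mult_sum M N \<in> formal" "bracket_sum M N \<in> formal"
    "a \<in> carrier F \<Longrightarrow> {#(a \<odot>\<^bsub>U\<^esub> u, v). (u, v) \<in># M#} \<in> formal"
  using assms bilinear_extension_formal bilinear_ops
  by (auto intro!: formal_sums_image intro: formal_sumsD[OF assms(1)])

end

lemma map_formal:
  assumes "g \<in> module_hom F V W" "M \<in> formal_sums U V"
  shows "{#(u, g v). (u, v) \<in># M#} \<in> formal_sums U W"
  using assms formal_sumsD[OF assms(2)]
  by (auto intro!: formal_sums_image simp: module_hom_def)

lemma poisson_homD:
  assumes "h \<in> poisson_hom F P Q"
  shows "h \<in> module_hom F P Q" "h \<in> ring_hom P Q"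
    and "x \<in> carrier P \<Longrightarrow> h x \<in> carrier Q"
    and "x \<in> carrier P \<Longrightarrow> y \<in> carrier P \<Longrightarrow> h (x \<oplus>\<^bsub>P\<^esub> y) = h x \<oplus>\<^bsub>Q\<^esub> h y"
    and "x \<in> carrier P \<Longrightarrow> y \<in> carrier P \<Longrightarrow> h (x \<otimes>\<^bsub>P\<^esub> y) = h x \<otimes>\<^bsub>Q\<^esub> h y"
    and "x \<in> carrier P \<Longrightarrow> y \<in> carrier P \<Longrightarrow> h \<lbrace>x, y\<rbrace>\<^bsub>P\<^esub> = \<lbrace>h x, h y\<rbrace>\<^bsub>Q\<^esub>"
    and "a \<in> carrier F \<Longrightarrow> x \<in> carrier P \<Longrightarrow> h (a \<odot>\<^bsub>P\<^esub> x) = a \<odot>\<^bsub>Q\<^esub> h x"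
    and "h \<one>\<^bsub>P\<^esub> = \<one>\<^bsub>Q\<^esub>"
  using assms by (auto simp: poisson_hom_def ring_hom_def module_hom_def)

lemma poisson_homI:
  assumes "\<And>x. x \<in> carrier P \<Longrightarrow> h x \<in> carrier Q"
    and "\<And>x y. x \<in> carrier P \<Longrightarrow> y \<in> carrier P \<Longrightarrow> h (x \<oplus>\<^bsub>P\<^esub> y) = h x \<oplus>\<^bsub>Q\<^esub> h y"
    and "\<And>x y. x \<in> carrier P \<Longrightarrow> y \<in> carrier P \<Longrightarrow> h (x \<otimes>\<^bsub>P\<^esub> y) = h x \<otimes>\<^bsub>Q\<^esub> h y"
    and "\<And>x y. x \<in> carrier P \<Longrightarrow> y \<in> carrier P \<Longrightarrow> h \<lbrace>x, y\<rbrace>\<^bsub>P\<^esub> = \<lbrace>h x, h y\<rbrace>\<^bsub>Q\<^esub>"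
    and "\<And>a x. a \<in> carrier F \<Longrightarrow> x \<in> carrier P \<Longrightarrow> h (a \<odot>\<^bsub>P\<^esub> x) = a \<odot>\<^bsub>Q\<^esub> h x"
    and "h \<one>\<^bsub>P\<^esub> = \<one>\<^bsub>Q\<^esub>"
  shows "h \<in> poisson_hom F P Q"
  using assms by (auto simp: poisson_hom_def ring_hom_def module_hom_def)

lemma poisson_hom_compose:
  "h \<in> poisson_hom F P Q \<Longrightarrow> k \<in> poisson_hom F Q R \<Longrightarrow> (\<lambda>x. k (h x)) \<in> poisson_hom F P R"
  by (rule poisson_homI) (simp_all add: poisson_homD)

text \<open>
  This holds already for formal sums, before passing to classes, since \<open>g\<close> acts on the second
  factors one summand at a time.
\<close>

lemma map_bilinear_extension:
  assumes "\<And>q s. q \<in> carrier V \<Longrightarrow> s \<in> carrier V \<Longrightarrow> g (B q s) = B' (g q) (g s)"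
    and M: "M \<in> formal_sums U V" and N: "N \<in> formal_sums U V"
  shows "{#(u, g v). (u, v) \<in># bilinear_extension A B M N#} =
    bilinear_extension A B' {#(u, g v). (u, v) \<in># M#} {#(u, g v). (u, v) \<in># N#}"
proof -
  have 1: "{#(u, g v). (u, v) \<in># (\<Sum>(r, s)\<in>#N. {#(A p r, B q s)#})#} =
      (\<Sum>(r, s)\<in># {#(u, g v). (u, v) \<in># N#}. {#(A p r, B' (g q) s)#})"
    if "q \<in> carrier V" for p q
    using N by (induction N) (auto simp: that assms(1))
  from M show ?thesis
    by (induction M) (auto simp: 1)
qed

text \<open>
  Functoriality of \<open>U \<otimes> _\<close> for Poisson homomorphisms. It allows homomorphisms into \<open>U \<otimes> V\<close> to be
  recognised by their images in other tensor products, without computing in \<open>U \<otimes> V\<close>.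
\<close>

lemma id_tensor_poisson_hom:
  assumes "poisson_algebra F U" "poisson_algebra F V" "poisson_algebra F W"
    and g: "g \<in> poisson_hom F V W"
  shows "id_tensor F U W g \<in> poisson_hom F (tensor_product F U V) (tensor_product F U W)"
proof -
  interpret U: poisson_algebra F U by fact
  interpret V: poisson_algebra F V by fact
  interpret W: poisson_algebra F W by fact
  interpret UV: tensor_poisson F U V ..
  interpret UW: tensor_poisson F U W ..
  note g_mod = poisson_homD(1)[OF g]
  have cls: "id_tensor F U W g (UV.cls M) = UW.cls {#(u, g v). (u, v) \<in># M#}"
    if "M \<in> UV.formal" for M
    using UV.tensor_class_unary_op[OF UV.tensor_eq_map[OF g_mod] that] by (simp add: id_tensor_def)
  note formal = map_formal[OF g_mod] UV.sums_formal
  note maps = map_bilinear_extension[where V=V and g=g and B="(\<otimes>\<^bsub>V\<^esub>)" and B'="(\<otimes>\<^bsub>W\<^esub>)", OF poisson_homD(5)[OF g]]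
    map_bilinear_extension[where V=V and g=g and B="bracket V" and B'="bracket W", OF poisson_homD(6)[OF g]]
  show ?thesis
  proof (rule poisson_homI, goal_cases)
    case (1 X)
    then show ?case by (auto simp: UV.tensor_product_carrier UW.tensor_product_carrier cls formal)
  next
    case (2 X Y)
    then show ?case
      by (auto simp: UV.tensor_product_carrier UV.tensor_product_class UW.tensor_product_class cls formal)
  next
    case (3 X Y)
    then show ?case
      by (auto simp: UV.tensor_product_carrier UV.tensor_product_class UW.tensor_product_class cls formal maps)
  next
    case (4 X Y)
    then show ?case
      using UV.sums_formal(2)
      by (auto simp: UV.tensor_product_carrier UV.tensor_product_class UW.tensor_product_class cls formal maps)
  next
    case (5 a X)
    then obtain M where M: "M \<in> UV.formal" "X = UV.cls M" by (auto simp: UV.tensor_product_carrier)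
    have "{#(u, g v). (u, v) \<in># {#(a \<odot>\<^bsub>U\<^esub> u, v). (u, v) \<in># M#}#} =
        {#(a \<odot>\<^bsub>U\<^esub> u, v). (u, v) \<in># {#(u, g v). (u, v) \<in># M#}#}"
      by (simp add: image_mset.compositionality o_def case_prod_beta)
    then show ?case using 5 M
      by (simp add: UV.tensor_product_class(4)[OF M(1) M(1)] UW.tensor_product_class(4)[OF formal(1)[OF M(1)] formal(1)[OF M(1)]] cls formal)
  next
    case 6
    then show ?case
      by (simp add: UV.tensor_product_one UW.tensor_product_one cls poisson_homD(8)[OF g])
  qed
qed

section \<open>Coordinates of a tensor\<close>

text \<open>
  The operations of a structure are unspecified outside its carrier, where the addition need not
  commute. Skipping summands outside the carrier makes the folded function left-commutative
  everywhere, as \<^term>\<open>fold_mset\<close> requires.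
\<close>

definition multiset_sum :: "('a, 'm) ring_scheme \<Rightarrow> 'a multiset \<Rightarrow> 'a" where
  "multiset_sum V =
    fold_mset (\<lambda>x y. if x \<in> carrier V \<and> y \<in> carrier V then x \<oplus>\<^bsub>V\<^esub> y else y) \<zero>\<^bsub>V\<^esub>"

context abelian_monoid
begin

lemma multiset_sum_empty [simp]: "multiset_sum G {#} = \<zero>"
  by (simp add: multiset_sum_def)

lemma multiset_sum_closed_add:
  assumes "set_mset M \<subseteq> carrier G"
  shows "multiset_sum G M \<in> carrier G \<and>
    (\<forall>x\<in>carrier G. multiset_sum G (add_mset x M) = x \<oplus> multiset_sum G M)"
proof -
  interpret comp_fun_commute "\<lambda>x y. if x \<in> carrier G \<and> y \<in> carrier G then x \<oplus> y else y"
    by unfold_locales (auto simp: fun_eq_iff a_lcomm)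
  show ?thesis
    using assms unfolding multiset_sum_def by (induction M) auto
qed

lemma multiset_sum_closed: "set_mset M \<subseteq> carrier G \<Longrightarrow> multiset_sum G M \<in> carrier G"
  using multiset_sum_closed_add by blast

lemma multiset_sum_add:
  "x \<in> carrier G \<Longrightarrow> set_mset M \<subseteq> carrier G \<Longrightarrow>
     multiset_sum G (add_mset x M) = x \<oplus> multiset_sum G M"
  using multiset_sum_closed_add by blast

lemma multiset_sum_union:
  assumes "set_mset N \<subseteq> carrier G"
  shows "set_mset M \<subseteq> carrier G \<Longrightarrow>
    multiset_sum G (M + N) = multiset_sum G M \<oplus> multiset_sum G N"
  using assms by (induction M) (simp_all add: multiset_sum_add multiset_sum_closed a_assoc)

end

definition formal_coordinate ::
  "('u \<Rightarrow> 'u \<Rightarrow> 'f) \<Rightarrow> ('f, 'v, 'n) module_scheme \<Rightarrow> 'u \<Rightarrow> ('u \<times> 'v) multiset \<Rightarrow> 'v" where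
  "formal_coordinate c V e M = multiset_sum V {#c e u \<odot>\<^bsub>V\<^esub> v. (u, v) \<in># M#}"

definition coordinate ::
  "('u \<Rightarrow> 'u \<Rightarrow> 'f) \<Rightarrow> ('f, 'v, 'n) module_scheme \<Rightarrow> 'u \<Rightarrow> ('u \<times> 'v) multiset set \<Rightarrow> 'v" where
  "coordinate c V e X = formal_coordinate c V e (SOME M. M \<in> X)"

definition basis_sum :: "'u set \<Rightarrow> ('u \<Rightarrow> 'v) \<Rightarrow> ('u \<times> 'v) multiset" where
  "basis_sum E x = {#(e, x e). e \<in># mset_set E#}"

text \<open>
  A finite basis together with its dual basis: \<open>c e u\<close> is the coefficient of \<open>e\<close> in \<open>u\<close>.
\<close>

locale coordinates = U: module F U
  for F :: "'f ring" and U :: "('f, 'u, 'm) module_scheme" +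
  fixes E :: "'u set" and c :: "'u \<Rightarrow> 'u \<Rightarrow> 'f"
  assumes finite_E: "finite E"
    and E_carrier: "e \<in> E \<Longrightarrow> e \<in> carrier U"
    and c_closed: "e \<in> E \<Longrightarrow> u \<in> carrier U \<Longrightarrow> c e u \<in> carrier F"
    and c_add: "e \<in> E \<Longrightarrow> u \<in> carrier U \<Longrightarrow> u' \<in> carrier U \<Longrightarrow>
      c e (u \<oplus>\<^bsub>U\<^esub> u') = c e u \<oplus>\<^bsub>F\<^esub> c e u'"
    and c_smult: "e \<in> E \<Longrightarrow> a \<in> carrier F \<Longrightarrow> u \<in> carrier U \<Longrightarrow>
      c e (a \<odot>\<^bsub>U\<^esub> u) = a \<otimes>\<^bsub>F\<^esub> c e u"
    and c_dual: "e \<in> E \<Longrightarrow> e' \<in> E \<Longrightarrow> c e e' = (if e = e' then \<one>\<^bsub>F\<^esub> else \<zero>\<^bsub>F\<^esub>)"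
    and c_expand: "u \<in> carrier U \<Longrightarrow> (\<Oplus>\<^bsub>U\<^esub>e\<in>E. c e u \<odot>\<^bsub>U\<^esub> e) = u"
begin

lemma c_zero: "e \<in> E \<Longrightarrow> c e \<zero>\<^bsub>U\<^esub> = \<zero>\<^bsub>F\<^esub>"
  using c_smult[of e "\<zero>\<^bsub>F\<^esub>" "\<zero>\<^bsub>U\<^esub>"] c_closed[of e "\<zero>\<^bsub>U\<^esub>"] by simp

end

locale tensor_coordinates = tensor F U V + coordinates F U E c
  for F :: "'f ring" and U :: "('f, 'u, 'm) module_scheme" and V :: "('f, 'v, 'n) module_scheme"
    and E :: "'u set" and c :: "'u \<Rightarrow> 'u \<Rightarrow> 'f"
begin

lemma terms_closed:
  "M \<in> formal \<Longrightarrow> e \<in> E \<Longrightarrow> set_mset {#c e u \<odot>\<^bsub>V\<^esub> v. (u, v) \<in># M#} \<subseteq> carrier V"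
  by (auto simp: c_closed formal_sums_def)

lemma formal_coordinate_closed:
  "M \<in> formal \<Longrightarrow> e \<in> E \<Longrightarrow> formal_coordinate c V e M \<in> carrier V"
  unfolding formal_coordinate_def by (intro V.M.multiset_sum_closed terms_closed)

lemma formal_coordinate_empty [simp]: "formal_coordinate c V e {#} = \<zero>\<^bsub>V\<^esub>"
  by (simp add: formal_coordinate_def)

lemma formal_coordinate_add:
  assumes "u \<in> carrier U" "v \<in> carrier V" "M \<in> formal" "e \<in> E"
  shows "formal_coordinate c V e (add_mset (u, v) M) =
    c e u \<odot>\<^bsub>V\<^esub> v \<oplus>\<^bsub>V\<^esub> formal_coordinate c V e M"
  using assms terms_closed[of M e]
  by (simp add: formal_coordinate_def V.M.multiset_sum_add c_closed)

lemma formal_coordinate_union: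
  assumes "M \<in> formal" "N \<in> formal" "e \<in> E"
  shows "formal_coordinate c V e (M + N) =
    formal_coordinate c V e M \<oplus>\<^bsub>V\<^esub> formal_coordinate c V e N"
  using terms_closed[OF assms(1,3)] terms_closed[OF assms(2,3)]
  by (simp add: formal_coordinate_def V.M.multiset_sum_union)

text \<open>
  The \<open>e\<close>-th coordinate is the map \<open>c e \<otimes> id\<close> from \<open>U \<otimes> V\<close> to \<open>F \<otimes> V = V\<close>, so it respects every
  relation that generates the congruence.
\<close>

lemma formal_coordinate_cong:
  assumes e: "e \<in> E"
  shows "M \<approx> N \<Longrightarrow> formal_coordinate c V e M = formal_coordinate c V e N"
proof (induction rule: tensor_eq.induct)
  case (plus M M' N)
  then show ?case using e tensor_eq_formal by (simp add: formal_coordinate_union)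
qed (use e in \<open>simp_all add: formal_coordinate_add c_zero c_add c_smult c_closed
    V.smult_l_distr V.smult_r_distr V.M.a_assoc V.smult_assoc1 U.R.m_comm[of _ "c e _"]\<close>)

lemma basis_sum_formal:
  "(\<And>e. e \<in> E \<Longrightarrow> x e \<in> carrier V) \<Longrightarrow> S \<subseteq> E \<Longrightarrow> basis_sum S x \<in> formal"
  using finite_subset[OF _ finite_E] E_carrier unfolding basis_sum_def
  by (auto intro!: formal_sums_image simp: subset_iff)

lemma basis_sum_insert:
  "finite S \<Longrightarrow> e \<notin> S \<Longrightarrow> basis_sum (insert e S) x = add_mset (e, x e) (basis_sum S x)"
  by (simp add: basis_sum_def)

lemma formal_coordinate_basis_sum:
  assumes x: "\<And>e. e \<in> E \<Longrightarrow> x e \<in> carrier V" and e: "e \<in> E"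
  shows "formal_coordinate c V e (basis_sum E x) = x e"
proof -
  have "formal_coordinate c V e (basis_sum S x) = (if e \<in> S then x e else \<zero>\<^bsub>V\<^esub>)"
    if "finite S" "S \<subseteq> E" for S
    using that
  proof (induction S)
    case empty
    then show ?case by (simp add: basis_sum_def)
  next
    case (insert k S)
    then have "formal_coordinate c V e (basis_sum (insert k S) x) =
        c e k \<odot>\<^bsub>V\<^esub> x k \<oplus>\<^bsub>V\<^esub> (if e \<in> S then x e else \<zero>\<^bsub>V\<^esub>)"
      using e by (simp add: basis_sum_insert formal_coordinate_add E_carrier x basis_sum_formal)
    then show ?case using insert e by (auto simp: c_dual x)
  qed
  from this[OF finite_E] e show ?thesis by simp
qed

lemma tensor_eq_finsum_left:
  assumes "v \<in> carrier V" "finite S" "S \<subseteq> E" "\<And>e. e \<in> E \<Longrightarrow> a e \<in> carrier F"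
  shows "{#(\<Oplus>\<^bsub>U\<^esub>e\<in>S. a e \<odot>\<^bsub>U\<^esub> e, v)#} \<approx> basis_sum S (\<lambda>e. a e \<odot>\<^bsub>V\<^esub> v)"
  using assms(2,3)
proof (induction S)
  case empty
  then show ?case using assms by (simp add: basis_sum_def tensor_eq.zero)
next
  case (insert e S)
  then have e: "e \<in> carrier U" "a e \<in> carrier F" and S: "(\<Oplus>\<^bsub>U\<^esub>e\<in>S. a e \<odot>\<^bsub>U\<^esub> e) \<in> carrier U"
    using assms(4) E_carrier by (auto intro!: U.M.finsum_closed)
  have "{#(\<Oplus>\<^bsub>U\<^esub>e\<in>insert e S. a e \<odot>\<^bsub>U\<^esub> e, v)#} \<approx>
      {#(a e \<odot>\<^bsub>U\<^esub> e, v)#} + {#(\<Oplus>\<^bsub>U\<^esub>e\<in>S. a e \<odot>\<^bsub>U\<^esub> e, v)#}"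
  proof -
    have "(\<Oplus>\<^bsub>U\<^esub>e\<in>insert e S. a e \<odot>\<^bsub>U\<^esub> e) = a e \<odot>\<^bsub>U\<^esub> e \<oplus>\<^bsub>U\<^esub> (\<Oplus>\<^bsub>U\<^esub>e\<in>S. a e \<odot>\<^bsub>U\<^esub> e)"
      using insert e assms(4) E_carrier by (intro U.M.finsum_insert) auto
    moreover have "{#(a e \<odot>\<^bsub>U\<^esub> e \<oplus>\<^bsub>U\<^esub> (\<Oplus>\<^bsub>U\<^esub>e\<in>S. a e \<odot>\<^bsub>U\<^esub> e), v)#} \<approx>
        {#(a e \<odot>\<^bsub>U\<^esub> e, v), (\<Oplus>\<^bsub>U\<^esub>e\<in>S. a e \<odot>\<^bsub>U\<^esub> e, v)#}"
      using e S assms(1) by (intro tensor_eq.add_left) auto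
    ultimately show ?thesis by (simp add: add_mset_commute)
  qed
  moreover have "{#(a e \<odot>\<^bsub>U\<^esub> e, v)#} + {#(\<Oplus>\<^bsub>U\<^esub>e\<in>S. a e \<odot>\<^bsub>U\<^esub> e, v)#} \<approx>
      {#(e, a e \<odot>\<^bsub>V\<^esub> v)#} + basis_sum S (\<lambda>e. a e \<odot>\<^bsub>V\<^esub> v)"
    using insert e assms(1) by (intro tensor_eq_union tensor_eq.smult) auto
  ultimately show ?case
    using insert by (auto simp: basis_sum_insert intro: tensor_eq.trans)
qed

lemma basis_sum_add:
  assumes "\<And>e. e \<in> E \<Longrightarrow> x e \<in> carrier V" "\<And>e. e \<in> E \<Longrightarrow> y e \<in> carrier V"
  shows "basis_sum E (\<lambda>e. x e \<oplus>\<^bsub>V\<^esub> y e) \<approx> basis_sum E x + basis_sum E y"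
proof -
  have *: "basis_sum E z = (\<Sum>e\<in>#mset_set E. {#(e, z e)#})" for z :: "'u \<Rightarrow> 'v"
    by (simp add: basis_sum_def)
  show ?thesis
    unfolding * sum_mset.distrib[symmetric]
  proof (rule tensor_eq_sum)
    fix e assume "e \<in># mset_set E"
    then have "e \<in> E" using finite_E by simp
    then have "{#(e, x e \<oplus>\<^bsub>V\<^esub> y e)#} \<approx> {#(e, x e), (e, y e)#}"
      using assms E_carrier by (intro tensor_eq.add_right) auto
    then show "{#(e, x e \<oplus>\<^bsub>V\<^esub> y e)#} \<approx> {#(e, x e)#} + {#(e, y e)#}"
      by (simp add: add_mset_commute)
  qed
qed

lemma basis_sum_cong: "(\<And>e. e \<in> E \<Longrightarrow> x e = y e) \<Longrightarrow> basis_sum E x = basis_sum E y"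
  unfolding basis_sum_def using finite_E by (intro image_mset_cong) auto

text \<open>
  Expanding every left factor in the basis and moving the scalars to the right brings a formal
  sum to the form \<open>\<Sum> e \<otimes> x\<^sub>e\<close>, and \<open>x\<^sub>e\<close> is its coordinate. Together with
  \<open>formal_coordinate_cong\<close> this says that coordinates determine a tensor.
\<close>

lemma tensor_eq_basis_sum:
  "M \<in> formal \<Longrightarrow> M \<approx> basis_sum E (\<lambda>e. formal_coordinate c V e M)"
proof (induction M)
  case empty
  \<comment> \<open>The empty sum corresponds to the sum of all \<open>e \<otimes> 0 = 0 e \<otimes> 0\<close>.\<close>
  have "basis_sum E (\<lambda>e. \<zero>\<^bsub>V\<^esub>) = basis_sum E (\<lambda>e. \<zero>\<^bsub>F\<^esub> \<odot>\<^bsub>V\<^esub> \<zero>\<^bsub>V\<^esub>)" by simp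
  also have "\<dots> \<approx> {#(\<Oplus>\<^bsub>U\<^esub>e\<in>E. \<zero>\<^bsub>F\<^esub> \<odot>\<^bsub>U\<^esub> e, \<zero>\<^bsub>V\<^esub>)#}"
    by (rule tensor_eq.sym, rule tensor_eq_finsum_left) (use finite_E in auto)
  also have "(\<Oplus>\<^bsub>U\<^esub>e\<in>E. \<zero>\<^bsub>F\<^esub> \<odot>\<^bsub>U\<^esub> e) = \<zero>\<^bsub>U\<^esub>"
    by (rule U.M.add.finprod_one_eqI) (simp add: E_carrier)
  finally show ?case
    using tensor_eq.zero[of "\<zero>\<^bsub>V\<^esub>" V F U] by (auto intro: tensor_eq.intros)
next
  case (add p M)
  obtain u v where p: "p = (u, v)" by force
  with add.prems have u: "u \<in> carrier U" and v: "v \<in> carrier V" and M: "M \<in> formal" by auto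
  have "{#(\<Oplus>\<^bsub>U\<^esub>e\<in>E. c e u \<odot>\<^bsub>U\<^esub> e, v)#} \<approx> basis_sum E (\<lambda>e. c e u \<odot>\<^bsub>V\<^esub> v)"
    by (rule tensor_eq_finsum_left) (use v finite_E c_closed u in auto)
  then have "{#(u, v)#} \<approx> basis_sum E (\<lambda>e. c e u \<odot>\<^bsub>V\<^esub> v)" using c_expand u by simp
  then have "{#(u, v)#} + M \<approx>
      basis_sum E (\<lambda>e. c e u \<odot>\<^bsub>V\<^esub> v) + basis_sum E (\<lambda>e. formal_coordinate c V e M)"
    using add.IH M by (intro tensor_eq_union)
  moreover have "basis_sum E (\<lambda>e. c e u \<odot>\<^bsub>V\<^esub> v \<oplus>\<^bsub>V\<^esub> formal_coordinate c V e M) \<approx>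
      basis_sum E (\<lambda>e. c e u \<odot>\<^bsub>V\<^esub> v) + basis_sum E (\<lambda>e. formal_coordinate c V e M)"
    using u v M by (intro basis_sum_add) (auto simp: c_closed formal_coordinate_closed)
  moreover have "basis_sum E (\<lambda>e. c e u \<odot>\<^bsub>V\<^esub> v \<oplus>\<^bsub>V\<^esub> formal_coordinate c V e M) =
      basis_sum E (\<lambda>e. formal_coordinate c V e (add_mset p M))"
    using u v M p by (intro basis_sum_cong) (simp add: formal_coordinate_add)
  ultimately show ?case
    using p by (auto intro: tensor_eq.intros)
qed

lemma coordinate_class:
  assumes "M \<in> formal" "e \<in> E"
  shows "coordinate c V e (cls M) = formal_coordinate c V e M"
proof -
  have "(SOME N. N \<in> cls M) \<in> cls M"
    using in_tensor_class[OF assms(1)] by (rule someI)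
  then show ?thesis
    unfolding coordinate_def using formal_coordinate_cong[OF assms(2)]
    by (metis tensor_class_def mem_Collect_eq)
qed

lemma coordinate_closed:
  "X \<in> cls ` formal \<Longrightarrow> e \<in> E \<Longrightarrow> coordinate c V e X \<in> carrier V"
  by (auto simp: coordinate_class formal_coordinate_closed)

lemma coordinate_basis_sum:
  "(\<And>e. e \<in> E \<Longrightarrow> x e \<in> carrier V) \<Longrightarrow> e \<in> E \<Longrightarrow> coordinate c V e (cls (basis_sum E x)) = x e"
  by (simp add: coordinate_class basis_sum_formal formal_coordinate_basis_sum)

lemma tensor_eqI_coordinates:
  assumes "X \<in> cls ` formal" "Y \<in> cls ` formal"
    and "\<And>e. e \<in> E \<Longrightarrow> coordinate c V e X = coordinate c V e Y"
  shows "X = Y"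
proof -
  obtain M N where M: "M \<in> formal" "X = cls M" and N: "N \<in> formal" "Y = cls N"
    using assms(1,2) by auto
  have "basis_sum E (\<lambda>e. formal_coordinate c V e M) = basis_sum E (\<lambda>e. formal_coordinate c V e N)"
    using assms(3) M N by (intro basis_sum_cong) (simp add: coordinate_class)
  with tensor_eq_basis_sum[OF M(1)] tensor_eq_basis_sum[OF N(1)] have "M \<approx> N"
    by (auto intro: tensor_eq.intros)
  then show ?thesis using M N by (simp add: tensor_class_eq_iff)
qed

lemma coordinate_id_tensor:
  assumes W: "module F W" and g: "g \<in> module_hom F V W" and X: "X \<in> cls ` formal" and e: "e \<in> E"
  shows "coordinate c W e (\<Union>M\<in>X. tensor_class F U W {#(u, g v). (u, v) \<in># M#}) = g (coordinate c V e X)"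
proof -
  interpret W: module F W by fact
  interpret UW: tensor_coordinates F U W E c ..
  interpret g: mod_hom F V W g by unfold_locales (rule g)
  obtain M where M: "M \<in> formal" "X = cls M" using X by auto
  have "formal_coordinate c W e {#(u, g v). (u, v) \<in># M#} = g (formal_coordinate c V e M)"
    using M(1)
  proof (induction M)
    case (add p M)
    then show ?case
      using e map_formal[OF g, of M U] module_hom_closed[OF g]
      by (cases p) (auto simp: Pi_iff UW.formal_coordinate_add formal_coordinate_add
          formal_coordinate_closed c_closed)
  qed simp
  then show ?thesis
    using M e by (simp add: tensor_class_unary_op[OF tensor_eq_map[OF g]] coordinate_class
        UW.coordinate_class map_formal[OF g])
qed

end

text \<open>
  The coordinate functions are linear because the expansion in a basis is unique.
\<close>

lemma coordinates_exist:
  fixes F :: "'f ring" and U :: "('f, 'u, 'm) module_scheme"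
  assumes "vectorspace F U" "vectorspace.fin_dim F U"
  shows "\<exists>E c. coordinates F U E c"
proof -
  interpret vectorspace F U by fact
  obtain E where E: "finite E" "basis E" using finite_basis_exists assms(2) by blast
  then have E_sub: "E \<subseteq> carrier U" by (simp add: basis_def)
  define a where "a u = (THE a. a \<in> E \<rightarrow>\<^sub>E carrier F \<and> lincomb a E = u)" for u
  have ex1: "\<exists>!a. a \<in> E \<rightarrow>\<^sub>E carrier F \<and> lincomb a E = u" if "u \<in> carrier U" for u
    using basis_criterion[OF E(1) E_sub] E(2) that by blast
  have a: "a u \<in> E \<rightarrow>\<^sub>E carrier F" "lincomb (a u) E = u" if "u \<in> carrier U" for u
    using theI'[OF ex1[OF that]] unfolding a_def by auto
  have a_unique: "a u e = b e"
    if "u \<in> carrier U" "b \<in> E \<rightarrow> carrier F" "lincomb b E = u" "e \<in> E" for u b e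
  proof -
    have "lincomb (restrict b E) E = lincomb b E"
      unfolding lincomb_def using that(2) E_sub by (intro M.finsum_cong') auto
    then have "a u = restrict b E"
      using ex1[OF that(1)] a[OF that(1)] that(2,3) by (metis restrict_PiE_iff Pi_iff)
    then show ?thesis using that(4) by simp
  qed
  have a_closed: "a u e \<in> carrier F" if "u \<in> carrier U" "e \<in> E" for u e
    using a(1)[OF that(1)] that(2) by auto
  have "coordinates F U E (\<lambda>e u. a u e)"
  proof (unfold_locales, goal_cases)
    case (4 e u u')
    have "lincomb (\<lambda>e. a u e \<oplus>\<^bsub>F\<^esub> a u' e) E =
        (\<Oplus>\<^bsub>U\<^esub>v\<in>E. a u v \<odot>\<^bsub>U\<^esub> v \<oplus>\<^bsub>U\<^esub> a u' v \<odot>\<^bsub>U\<^esub> v)"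
      using 4 E_sub a_closed unfolding lincomb_def
      by (intro M.finsum_cong') (auto simp: smult_l_distr subset_iff)
    also have "\<dots> = lincomb (a u) E \<oplus>\<^bsub>U\<^esub> lincomb (a u') E"
      using 4 E_sub a_closed unfolding lincomb_def by (intro M.finsum_addf) auto
    finally have "lincomb (\<lambda>e. a u e \<oplus>\<^bsub>F\<^esub> a u' e) E = lincomb (a u) E \<oplus>\<^bsub>U\<^esub> lincomb (a u') E" .
    then show ?case using 4 a a_closed by (intro a_unique) auto
  next
    case (5 e b u)
    have "lincomb (\<lambda>e. b \<otimes>\<^bsub>F\<^esub> a u e) E = b \<odot>\<^bsub>U\<^esub> lincomb (a u) E"
      using 5 E_sub E(1) a_closed unfolding lincomb_def
      by (subst finsum_smult_ldistr)
        (auto intro!: M.finsum_cong' simp: smult_assoc1 subset_iff)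
    then show ?case using 5 a a_closed by (intro a_unique) auto
  next
    case (6 e e')
    have "lincomb (\<lambda>k. if k = e' then \<one>\<^bsub>F\<^esub> else \<zero>\<^bsub>F\<^esub>) E =
        (\<Oplus>\<^bsub>U\<^esub>k\<in>E. if e' = k then k else \<zero>\<^bsub>U\<^esub>)"
      using E_sub unfolding lincomb_def by (intro M.finsum_cong') auto
    also have "\<dots> = e'" using 6 E(1) E_sub by (intro M.finsum_singleton) auto
    finally show ?case using 6 E_sub by (intro a_unique) auto
  qed (use E E_sub a a_closed in \<open>auto simp: lincomb_def\<close>)
  then show ?thesis by blast
qed

section \<open>Poisson algebras of terms\<close>

text \<open>
  The laws that come from commutative rings and modules, collected for the transfer to an algebra
  that embeds in others. The inverse of addition enters as multiplication by the scalar \<open>-1\<close>,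
  which homomorphisms visibly preserve.
\<close>

lemma (in poisson_algebra) poisson_laws:
  shows "\<lbrakk>x \<in> carrier P; y \<in> carrier P; z \<in> carrier P\<rbrakk> \<Longrightarrow> (x \<oplus>\<^bsub>P\<^esub> y) \<oplus>\<^bsub>P\<^esub> z = x \<oplus>\<^bsub>P\<^esub> (y \<oplus>\<^bsub>P\<^esub> z)"
    and "\<lbrakk>x \<in> carrier P; y \<in> carrier P\<rbrakk> \<Longrightarrow> x \<oplus>\<^bsub>P\<^esub> y = y \<oplus>\<^bsub>P\<^esub> x"
    and "x \<in> carrier P \<Longrightarrow> \<zero>\<^bsub>P\<^esub> \<oplus>\<^bsub>P\<^esub> x = x"
    and "x \<in> carrier P \<Longrightarrow> (\<ominus>\<^bsub>F\<^esub> \<one>\<^bsub>F\<^esub>) \<odot>\<^bsub>P\<^esub> x \<oplus>\<^bsub>P\<^esub> x = \<zero>\<^bsub>P\<^esub>"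
    and "\<lbrakk>x \<in> carrier P; y \<in> carrier P; z \<in> carrier P\<rbrakk> \<Longrightarrow> (x \<otimes>\<^bsub>P\<^esub> y) \<otimes>\<^bsub>P\<^esub> z = x \<otimes>\<^bsub>P\<^esub> (y \<otimes>\<^bsub>P\<^esub> z)"
    and "\<lbrakk>x \<in> carrier P; y \<in> carrier P\<rbrakk> \<Longrightarrow> x \<otimes>\<^bsub>P\<^esub> y = y \<otimes>\<^bsub>P\<^esub> x"
    and "x \<in> carrier P \<Longrightarrow> \<one>\<^bsub>P\<^esub> \<otimes>\<^bsub>P\<^esub> x = x"
    and "\<lbrakk>x \<in> carrier P; y \<in> carrier P; z \<in> carrier P\<rbrakk> \<Longrightarrow>
      (x \<oplus>\<^bsub>P\<^esub> y) \<otimes>\<^bsub>P\<^esub> z = x \<otimes>\<^bsub>P\<^esub> z \<oplus>\<^bsub>P\<^esub> y \<otimes>\<^bsub>P\<^esub> z"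
    and "\<lbrakk>a \<in> carrier F; b \<in> carrier F; x \<in> carrier P\<rbrakk> \<Longrightarrow>
      (a \<oplus>\<^bsub>F\<^esub> b) \<odot>\<^bsub>P\<^esub> x = a \<odot>\<^bsub>P\<^esub> x \<oplus>\<^bsub>P\<^esub> b \<odot>\<^bsub>P\<^esub> x"
    and "\<lbrakk>a \<in> carrier F; x \<in> carrier P; y \<in> carrier P\<rbrakk> \<Longrightarrow>
      a \<odot>\<^bsub>P\<^esub> (x \<oplus>\<^bsub>P\<^esub> y) = a \<odot>\<^bsub>P\<^esub> x \<oplus>\<^bsub>P\<^esub> a \<odot>\<^bsub>P\<^esub> y"
    and "\<lbrakk>a \<in> carrier F; b \<in> carrier F; x \<in> carrier P\<rbrakk> \<Longrightarrow> (a \<otimes>\<^bsub>F\<^esub> b) \<odot>\<^bsub>P\<^esub> x = a \<odot>\<^bsub>P\<^esub> (b \<odot>\<^bsub>P\<^esub> x)"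
    and "x \<in> carrier P \<Longrightarrow> \<one>\<^bsub>F\<^esub> \<odot>\<^bsub>P\<^esub> x = x"
    and "\<lbrakk>a \<in> carrier F; x \<in> carrier P; y \<in> carrier P\<rbrakk> \<Longrightarrow> (a \<odot>\<^bsub>P\<^esub> x) \<otimes>\<^bsub>P\<^esub> y = a \<odot>\<^bsub>P\<^esub> (x \<otimes>\<^bsub>P\<^esub> y)"
  by (auto simp: M.l_neg smult_l_minus smult_l_distr smult_r_distr smult_assoc1 smult_assoc2
      intro: M.a_assoc M.a_comm m_assoc m_comm l_distr)

text \<open>
  An identity between closed operations can be checked after applying a jointly injective family
  of maps that preserve them. The only axiom of a Poisson algebra that is not of this form is the
  existence of negatives, and \<open>(-1) x\<close> provides them.
\<close>

lemma poisson_algebra_jointly_embedded: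
  fixes F :: "'f ring" and B :: "('f, 'b) poisson" and R :: "'k \<Rightarrow> ('f, 'q) poisson"
  assumes F: "cring F"
    and R: "\<And>k. k \<in> K \<Longrightarrow> poisson_algebra F (R k)"
    and closed: "\<zero>\<^bsub>B\<^esub> \<in> carrier B" "\<one>\<^bsub>B\<^esub> \<in> carrier B"
      "\<And>x y. x \<in> carrier B \<Longrightarrow> y \<in> carrier B \<Longrightarrow> x \<oplus>\<^bsub>B\<^esub> y \<in> carrier B"
      "\<And>x y. x \<in> carrier B \<Longrightarrow> y \<in> carrier B \<Longrightarrow> x \<otimes>\<^bsub>B\<^esub> y \<in> carrier B"
      "\<And>x y. x \<in> carrier B \<Longrightarrow> y \<in> carrier B \<Longrightarrow> \<lbrace>x, y\<rbrace>\<^bsub>B\<^esub> \<in> carrier B"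
      "\<And>a x. a \<in> carrier F \<Longrightarrow> x \<in> carrier B \<Longrightarrow> a \<odot>\<^bsub>B\<^esub> x \<in> carrier B"
    and hom: "\<And>k. k \<in> K \<Longrightarrow> h k \<in> poisson_hom F B (R k)"
      "\<And>k. k \<in> K \<Longrightarrow> h k \<zero>\<^bsub>B\<^esub> = \<zero>\<^bsub>R k\<^esub>"
    and joint: "\<And>x y. x \<in> carrier B \<Longrightarrow> y \<in> carrier B \<Longrightarrow> (\<And>k. k \<in> K \<Longrightarrow> h k x = h k y) \<Longrightarrow> x = y"
  shows "poisson_algebra F B"
proof -
  interpret F: cring F by fact
  note homs = poisson_homD(3-8)[OF hom(1)] hom(2)
  note laws = poisson_algebra.poisson_laws[OF R]
  have neg: "\<exists>y\<in>carrier B. y \<oplus>\<^bsub>B\<^esub> x = \<zero>\<^bsub>B\<^esub>" if "x \<in> carrier B" for x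
  proof
    show "(\<ominus>\<^bsub>F\<^esub> \<one>\<^bsub>F\<^esub>) \<odot>\<^bsub>B\<^esub> x \<in> carrier B" using that by (simp add: closed)
    show "(\<ominus>\<^bsub>F\<^esub> \<one>\<^bsub>F\<^esub>) \<odot>\<^bsub>B\<^esub> x \<oplus>\<^bsub>B\<^esub> x = \<zero>\<^bsub>B\<^esub>"
      using that by (intro joint) (auto simp: closed homs intro!: laws(4))
  qed
  have "abelian_group B"
  proof (rule abelian_groupI, goal_cases)
    case (3 x y z)
    then show ?case by (intro joint) (auto simp: closed homs intro!: laws(1))
  next
    case (4 x y)
    then show ?case by (intro joint) (auto simp: closed homs intro!: laws(2))
  next
    case (5 x)
    then show ?case by (intro joint) (auto simp: closed homs intro!: laws(3))
  qed (simp_all add: closed neg)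
  moreover have "comm_monoid B"
  proof (rule comm_monoidI, goal_cases)
    case (3 x y z)
    then show ?case by (intro joint) (auto simp: closed homs intro!: laws(5))
  next
    case (4 x)
    then show ?case by (intro joint) (auto simp: closed homs intro!: laws(7))
  next
    case (5 x y)
    then show ?case by (intro joint) (auto simp: closed homs intro!: laws(6))
  qed (simp_all add: closed)
  ultimately have "cring B"
  proof (rule cringI, goal_cases)
    case (1 x y z)
    then show ?case by (intro joint) (auto simp: closed homs intro!: laws(8))
  qed
  then have "algebra F B"
  proof (rule algebraI[OF F], goal_cases)
    case (2 a b x)
    then show ?case by (intro joint) (auto simp: closed homs intro!: laws(9))
  next
    case (3 a x y)
    then show ?case by (intro joint) (auto simp: closed homs intro!: laws(10))
  next
    case (4 a b x)
    then show ?case by (intro joint) (auto simp: closed homs intro!: laws(11))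
  next
    case (5 x)
    then show ?case by (intro joint) (auto simp: closed homs intro!: laws(12))
  next
    case (6 a x y)
    then show ?case by (intro joint) (auto simp: closed homs intro!: laws(13))
  qed (simp_all add: closed)
  then show ?thesis
  proof (intro poisson_algebra.intro poisson_algebra_axioms.intro, goal_cases)
    case (3 x y z)
    then show ?case by (intro joint)
      (auto simp: closed homs poisson_algebra.bracket_add_left[OF R])
  next
    case (4 x y z)
    then show ?case by (intro joint)
      (auto simp: closed homs poisson_algebra.bracket_add_right[OF R])
  next
    case (5 a x y)
    then show ?case by (intro joint)
      (auto simp: closed homs poisson_algebra.bracket_smult_left[OF R])
  next
    case (6 a x y)
    then show ?case by (intro joint)
      (auto simp: closed homs poisson_algebra.bracket_smult_right[OF R])
  next
    case (7 x)
    then show ?case by (intro joint)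
      (auto simp: closed homs poisson_algebra.bracket_alternating[OF R])
  next
    case (8 x y z)
    then show ?case by (intro joint)
      (auto simp: closed homs poisson_algebra.jacobi[OF R])
  next
    case (9 x y z)
    then show ?case by (intro joint)
      (auto simp: closed homs poisson_algebra.leibniz[OF R])
  qed (simp_all add: closed)
qed

primrec wf_term :: "'f set \<Rightarrow> 'u set \<Rightarrow> 'p set \<Rightarrow> ('f, 'p, 'u) poisson_term \<Rightarrow> bool" where
  "wf_term S E A (Gen e p) \<longleftrightarrow> e \<in> E \<and> p \<in> A"
| "wf_term S E A One \<longleftrightarrow> True"
| "wf_term S E A (Add s t) \<longleftrightarrow> wf_term S E A s \<and> wf_term S E A t"
| "wf_term S E A (Smult a t) \<longleftrightarrow> a \<in> S \<and> wf_term S E A t"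
| "wf_term S E A (Mult s t) \<longleftrightarrow> wf_term S E A s \<and> wf_term S E A t"
| "wf_term S E A (Bracket s t) \<longleftrightarrow> wf_term S E A s \<and> wf_term S E A t"

primrec term_value :: "('f, 'q) poisson \<Rightarrow> ('u \<Rightarrow> 'p \<Rightarrow> 'q) \<Rightarrow> ('f, 'p, 'u) poisson_term \<Rightarrow> 'q" where
  "term_value Q v (Gen e p) = v e p"
| "term_value Q v One = \<one>\<^bsub>Q\<^esub>"
| "term_value Q v (Add s t) = term_value Q v s \<oplus>\<^bsub>Q\<^esub> term_value Q v t"
| "term_value Q v (Smult a t) = a \<odot>\<^bsub>Q\<^esub> term_value Q v t"
| "term_value Q v (Mult s t) = term_value Q v s \<otimes>\<^bsub>Q\<^esub> term_value Q v t"
| "term_value Q v (Bracket s t) = \<lbrace>term_value Q v s, term_value Q v t\<rbrace>\<^bsub>Q\<^esub>"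

lemma term_value_closed:
  assumes "poisson_algebra F Q" "\<And>e p. e \<in> E \<Longrightarrow> p \<in> A \<Longrightarrow> v e p \<in> carrier Q"
  shows "wf_term (carrier F) E A t \<Longrightarrow> term_value Q v t \<in> carrier Q"
proof -
  interpret poisson_algebra F Q by fact
  show "wf_term (carrier F) E A t \<Longrightarrow> term_value Q v t \<in> carrier Q"
    using assms(2) by (induction t) (simp_all add: bracket_closed)
qed

lemma term_value_cong:
  assumes "\<And>e p. e \<in> E \<Longrightarrow> p \<in> A \<Longrightarrow> v e p = w e p"
  shows "wf_term S E A t \<Longrightarrow> term_value Q v t = term_value Q w t"
  using assms by (induction t) simp_all

text \<open>
  Uniqueness in the universal property rests on this: on an algebra whose elements are all values
  of terms, a homomorphism is determined by what it does to the assigned generators.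
\<close>

lemma hom_term_value:
  assumes "poisson_algebra F B" "g \<in> poisson_hom F B Q"
    and v: "\<And>e p. e \<in> E \<Longrightarrow> p \<in> A \<Longrightarrow> v e p \<in> carrier B"
  shows "wf_term (carrier F) E A t \<Longrightarrow> g (term_value B v t) = term_value Q (\<lambda>e p. g (v e p)) t"
  by (induction t)
    (simp_all add: poisson_homD(4-8)[OF assms(2)] term_value_closed[where E=E and A=A, OF assms(1) v])

definition term_class ::
  "'f set \<Rightarrow> 'u set \<Rightarrow> 'p set \<Rightarrow> (('f, 'q) poisson \<times> ('u \<Rightarrow> 'p \<Rightarrow> 'q)) set
    \<Rightarrow> ('f, 'p, 'u) poisson_term \<Rightarrow> ('f, 'p, 'u) poisson_term set" where
  "term_class S E A K s =
    {t. wf_term S E A t \<and> (\<forall>(Q, v)\<in>K. term_value Q v t = term_value Q v s)}"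

definition representative :: "'a set \<Rightarrow> 'a" where
  "representative X = (SOME t. t \<in> X)"

text \<open>
  There is no term for zero, which is represented by \<open>0 \<cdot> 1\<close>. An empty \<open>K\<close> identifies all terms and
  leaves the zero algebra.
\<close>

definition term_algebra ::
  "'f ring \<Rightarrow> 'u set \<Rightarrow> 'p set \<Rightarrow> (('f, 'q) poisson \<times> ('u \<Rightarrow> 'p \<Rightarrow> 'q)) set
    \<Rightarrow> ('f, ('f, 'p, 'u) poisson_term set) poisson" where
  "term_algebra F E A K =
    (let C = term_class (carrier F) E A K; r = representative in
     \<lparr> carrier = C ` Collect (wf_term (carrier F) E A),
       mult = (\<lambda>X Y. C (Mult (r X) (r Y))),
       one = C One,
       zero = C (Smult \<zero>\<^bsub>F\<^esub> One),
       add = (\<lambda>X Y. C (Add (r X) (r Y))),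
       smult = (\<lambda>a X. C (Smult a (r X))),
       bracket = (\<lambda>X Y. C (Bracket (r X) (r Y))) \<rparr>)"

locale term_models =
  fixes F :: "'f ring" and E :: "'u set" and A :: "'p set"
    and K :: "(('f, 'q) poisson \<times> ('u \<Rightarrow> 'p \<Rightarrow> 'q)) set"
  assumes cring: "cring F"
    and model: "(Q, v) \<in> K \<Longrightarrow> poisson_algebra F Q"
    and value_closed: "(Q, v) \<in> K \<Longrightarrow> e \<in> E \<Longrightarrow> p \<in> A \<Longrightarrow> v e p \<in> carrier Q"
begin

abbreviation wf where "wf \<equiv> wf_term (carrier F) E A"
abbreviation C where "C \<equiv> term_class (carrier F) E A K"
abbreviation T where "T \<equiv> term_algebra F E A K"
abbreviation proj where "proj Q v X \<equiv> term_value Q v (representative X)"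

lemma representative_class:
  assumes "wf t"
  shows "wf (representative (C t))"
    and "(Q, v) \<in> K \<Longrightarrow> proj Q v (C t) = term_value Q v t"
proof -
  have "t \<in> C t" using assms by (simp add: term_class_def)
  then have "representative (C t) \<in> C t" unfolding representative_def by (rule someI)
  then show "wf (representative (C t))"
    and "(Q, v) \<in> K \<Longrightarrow> proj Q v (C t) = term_value Q v t"
    by (auto simp: term_class_def)
qed

lemma T_carrier: "carrier T = C ` Collect wf"
  by (simp add: term_algebra_def Let_def)

lemma C_closed: "wf t \<Longrightarrow> C t \<in> carrier T"
  by (simp add: T_carrier)

lemma representative_wf: "X \<in> carrier T \<Longrightarrow> wf (representative X)"
  by (auto simp: T_carrier representative_class)

lemma T_ops:
  "X \<oplus>\<^bsub>T\<^esub> Y = C (Add (representative X) (representative Y))"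
  "X \<otimes>\<^bsub>T\<^esub> Y = C (Mult (representative X) (representative Y))"
  "\<lbrace>X, Y\<rbrace>\<^bsub>T\<^esub> = C (Bracket (representative X) (representative Y))"
  "a \<odot>\<^bsub>T\<^esub> X = C (Smult a (representative X))"
  "\<one>\<^bsub>T\<^esub> = C One"
  "\<zero>\<^bsub>T\<^esub> = C (Smult \<zero>\<^bsub>F\<^esub> One)"
  by (simp_all add: term_algebra_def Let_def)

lemma term_value_model:
  assumes "(Q, v) \<in> K" "wf t"
  shows "term_value Q v t \<in> carrier Q"
  by (rule term_value_closed[OF model[OF assms(1)] value_closed[OF assms(1)] assms(2)])

lemma proj_hom: "(Q, v) \<in> K \<Longrightarrow> proj Q v \<in> poisson_hom F T Q"
  by (rule poisson_homI)
    (simp_all add: T_ops representative_class representative_wf term_value_model)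

lemma proj_joint:
  assumes "X \<in> carrier T" "Y \<in> carrier T" "\<And>Q v. (Q, v) \<in> K \<Longrightarrow> proj Q v X = proj Q v Y"
  shows "X = Y"
proof -
  obtain s t where s: "wf s" "X = C s" and t: "wf t" "Y = C t"
    using assms(1,2) by (auto simp: T_carrier)
  then have "term_value Q v s = term_value Q v t" if "(Q, v) \<in> K" for Q v
    using assms(3)[OF that] that by (simp add: representative_class)
  then show ?thesis
    unfolding s t term_class_def by (auto split: prod.splits)
qed

lemma poisson_algebra_T: "poisson_algebra F T"
proof -
  interpret F: cring F by (rule cring)
  show ?thesis
  proof (rule poisson_algebra_jointly_embedded[where K=K and R=fst and h="\<lambda>(Q, v). proj Q v", OF cring],
      goal_cases)
    case (9 k)
    then obtain Q v where k: "k = (Q, v)" "(Q, v) \<in> K" by (cases k) auto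
    interpret Q: poisson_algebra F Q using k by (auto intro: model)
    show ?case using k by (simp add: T_ops representative_class)
  next
    case (10 X Y)
    then show ?case by (intro proj_joint) auto
  qed (auto simp: T_ops C_closed representative_wf model proj_hom)
qed

text \<open>
  A class is the value of its representatives at the classes of the generators; in particular
  these classes generate the term algebra.
\<close>

lemma C_eq_term_value:
  assumes "wf t"
  shows "C t = term_value T (\<lambda>e p. C (Gen e p)) t"
proof (rule proj_joint)
  have gen: "C (Gen e p) \<in> carrier T" if "e \<in> E" "p \<in> A" for e p
    using that by (simp add: C_closed)
  show "C t \<in> carrier T" using assms by (rule C_closed)
  show "term_value T (\<lambda>e p. C (Gen e p)) t \<in> carrier T"
    by (rule term_value_closed[OF poisson_algebra_T gen assms])
  fix Q v assume Qv: "(Q, v) \<in> K"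
  have "proj Q v (term_value T (\<lambda>e p. C (Gen e p)) t) =
      term_value Q (\<lambda>e p. proj Q v (C (Gen e p))) t"
    by (rule hom_term_value[OF poisson_algebra_T proj_hom[OF Qv] gen assms])
  also have "\<dots> = term_value Q v t"
    by (rule term_value_cong[OF _ assms]) (simp add: representative_class Qv)
  finally show "proj Q v (C t) = proj Q v (term_value T (\<lambda>e p. C (Gen e p)) t)"
    using Qv assms by (simp add: representative_class)
qed

end

section \<open>The universal property\<close>

lemma tensor_product_closed:
  assumes "poisson_algebra F U" "poisson_algebra F V"
  shows "X \<in> carrier (tensor_product F U V) \<Longrightarrow> Y \<in> carrier (tensor_product F U V) \<Longrightarrow>
      X \<oplus>\<^bsub>tensor_product F U V\<^esub> Y \<in> carrier (tensor_product F U V)"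
    and "X \<in> carrier (tensor_product F U V) \<Longrightarrow> Y \<in> carrier (tensor_product F U V) \<Longrightarrow>
      X \<otimes>\<^bsub>tensor_product F U V\<^esub> Y \<in> carrier (tensor_product F U V)"
    and "X \<in> carrier (tensor_product F U V) \<Longrightarrow> Y \<in> carrier (tensor_product F U V) \<Longrightarrow>
      \<lbrace>X, Y\<rbrace>\<^bsub>tensor_product F U V\<^esub> \<in> carrier (tensor_product F U V)"
    and "a \<in> carrier F \<Longrightarrow> X \<in> carrier (tensor_product F U V) \<Longrightarrow>
      a \<odot>\<^bsub>tensor_product F U V\<^esub> X \<in> carrier (tensor_product F U V)"
    and "\<one>\<^bsub>tensor_product F U V\<^esub> \<in> carrier (tensor_product F U V)"
proof -
  interpret U: poisson_algebra F U by fact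
  interpret V: poisson_algebra F V by fact
  interpret tensor_poisson F U V ..
  have binary: "cls (M + N) \<in> cls ` formal" "cls (mult_sum M N) \<in> cls ` formal"
    "cls (bracket_sum M N) \<in> cls ` formal" if "M \<in> formal" "N \<in> formal" for M N
    using sums_formal[OF that] that by (intro imageI; simp)+
  show "X \<in> carrier UV \<Longrightarrow> Y \<in> carrier UV \<Longrightarrow> X \<oplus>\<^bsub>UV\<^esub> Y \<in> carrier UV"
    "X \<in> carrier UV \<Longrightarrow> Y \<in> carrier UV \<Longrightarrow> X \<otimes>\<^bsub>UV\<^esub> Y \<in> carrier UV"
    "X \<in> carrier UV \<Longrightarrow> Y \<in> carrier UV \<Longrightarrow> \<lbrace>X, Y\<rbrace>\<^bsub>UV\<^esub> \<in> carrier UV"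
    unfolding tensor_product_carrier by (auto simp: tensor_product_class intro: binary)
  show "a \<odot>\<^bsub>UV\<^esub> X \<in> carrier UV" if a: "a \<in> carrier F" and X: "X \<in> carrier UV"
  proof -
    obtain M where M: "M \<in> formal" "X = cls M" using X by (auto simp: tensor_product_carrier)
    then show ?thesis
      using tensor_product_class(4)[OF M(1) M(1) a] sums_formal(3)[OF M(1) M(1) a]
      by (simp add: tensor_product_carrier)
  qed
  show "\<one>\<^bsub>UV\<^esub> \<in> carrier UV"
    by (simp add: tensor_product_one tensor_product_carrier)
qed

lemma poisson_hom_cong:
  assumes P: "poisson_algebra F P" and h: "h \<in> poisson_hom F P Q"
    and "\<And>x. x \<in> carrier P \<Longrightarrow> h' x = h x"
  shows "h' \<in> poisson_hom F P Q"
proof -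
  interpret poisson_algebra F P by fact
  show ?thesis
    by (rule poisson_homI) (simp_all add: assms(3) bracket_closed poisson_homD[OF h])
qed

locale hom_problem = P: poisson_algebra F P + U: poisson_algebra F U + coordinates F U E c
  for F :: "'f ring" and P :: "('f, 'p) poisson" and U :: "('f, 'u) poisson"
    and E :: "'u set" and c :: "'u \<Rightarrow> 'u \<Rightarrow> 'f"
begin

abbreviation tensor_with (infixr "\<otimes>\<^sub>F" 70) where "V \<otimes>\<^sub>F Q \<equiv> tensor_product F V Q"

definition coeff :: "('f, 'q) poisson \<Rightarrow> ('p \<Rightarrow> ('u \<times> 'q) multiset set) \<Rightarrow> 'u \<Rightarrow> 'p \<Rightarrow> 'q" where
  "coeff Q f e p = coordinate c Q e (f p)"

lemma tensor_coordinatesI: "poisson_algebra F Q \<Longrightarrow> tensor_coordinates F U Q E c"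
proof -
  assume "poisson_algebra F Q"
  then interpret Q: poisson_algebra F Q .
  show ?thesis ..
qed

lemma coeff_closed:
  assumes "poisson_algebra F Q" "f \<in> poisson_hom F P (U \<otimes>\<^sub>F Q)" "e \<in> E" "p \<in> carrier P"
  shows "coeff Q f e p \<in> carrier Q"
proof -
  interpret tensor_coordinates F U Q E c using assms(1) by (rule tensor_coordinatesI)
  show ?thesis
    using poisson_homD(3)[OF assms(2,4)] assms(3) coordinate_closed
    by (simp add: coeff_def tensor_product_def)
qed

lemma coordinate_id_tensor:
  assumes "poisson_algebra F V" "poisson_algebra F W" "g \<in> poisson_hom F V W"
    "X \<in> carrier (U \<otimes>\<^sub>F V)" "e \<in> E"
  shows "coordinate c W e (id_tensor F U W g X) = g (coordinate c V e X)"
proof -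
  interpret tensor_coordinates F U V E c using assms(1) by (rule tensor_coordinatesI)
  interpret W: poisson_algebra F W by fact
  show ?thesis
    using coordinate_id_tensor[OF W.module_axioms poisson_homD(1)[OF assms(3)], of X e] assms(4,5)
    by (simp add: id_tensor_def tensor_product_def)
qed

lemma tensor_eqI:
  assumes "poisson_algebra F Q" "X \<in> carrier (U \<otimes>\<^sub>F Q)" "Y \<in> carrier (U \<otimes>\<^sub>F Q)"
    and "\<And>e. e \<in> E \<Longrightarrow> coordinate c Q e X = coordinate c Q e Y"
  shows "X = Y"
proof -
  interpret tensor_coordinates F U Q E c using assms(1) by (rule tensor_coordinatesI)
  show ?thesis using assms(2-4) by (intro tensor_eqI_coordinates) (simp_all add: tensor_product_def)
qed

lemma coeff_id_tensor:
  assumes "poisson_algebra F B" "\<psi> \<in> poisson_hom F P (U \<otimes>\<^sub>F B)"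
    and "poisson_algebra F Q" "g \<in> poisson_hom F B Q"
    and "\<And>p. p \<in> carrier P \<Longrightarrow> id_tensor F U Q g (\<psi> p) = f p" "e \<in> E" "p \<in> carrier P"
  shows "coeff Q f e p = g (coeff B \<psi> e p)"
  using coordinate_id_tensor[OF assms(1,3,4) poisson_homD(3)[OF assms(2,7)] assms(6)] assms(5,7)
  by (simp add: coeff_def)

end

text \<open>
  An arbitrary set \<open>H\<close> of homomorphisms \<open>f\<close> from \<open>P\<close> to \<open>U \<otimes> Q\<close>, each given with its \<open>Q\<close>. The set
  of all of them leads to the universal algebra, a single one to the subalgebra that it
  generates in its \<open>Q\<close>.
\<close>

locale hom_family = hom_problem F P U E c
  for F :: "'f ring" and P :: "('f, 'p) poisson" and U :: "('f, 'u) poisson"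
    and E :: "'u set" and c :: "'u \<Rightarrow> 'u \<Rightarrow> 'f" +
  fixes H :: "(('f, 'q) poisson \<times> ('p \<Rightarrow> ('u \<times> 'q) multiset set)) set"
  assumes H_poisson: "(Q, f) \<in> H \<Longrightarrow> poisson_algebra F Q"
    and H_hom: "(Q, f) \<in> H \<Longrightarrow> f \<in> poisson_hom F P (U \<otimes>\<^sub>F Q)"
begin

definition models where "models = (\<lambda>(Q, f). (Q, coeff Q f)) ` H"

sublocale term_models F E "carrier P" models
proof (rule term_models.intro)
  show "cring F" by (rule P.R_cring)
  fix Q v assume "(Q, v) \<in> models"
  then obtain f where f: "(Q, f) \<in> H" "v = coeff Q f" by (auto simp: models_def)
  show "poisson_algebra F Q" using H_poisson f by blast
  show "v e p \<in> carrier Q" if "e \<in> E" "p \<in> carrier P" for e p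
    using coeff_closed H_poisson H_hom f that by blast
qed

definition generic_hom where
  "generic_hom p = tensor_class F U T (basis_sum E (\<lambda>e. C (Gen e p)))"

abbreviation component where "component Q f \<equiv> (\<lambda>X. proj Q (coeff Q f) X)"

lemma component_hom: "(Q, f) \<in> H \<Longrightarrow> component Q f \<in> poisson_hom F T Q"
  by (rule proj_hom) (force simp: models_def)

sublocale UT: tensor_coordinates F U T E c
  by (rule tensor_coordinatesI[OF poisson_algebra_T])

lemma generator_closed: "e \<in> E \<Longrightarrow> p \<in> carrier P \<Longrightarrow> C (Gen e p) \<in> carrier T"
  by (simp add: C_closed)

lemma generic_hom_closed: "p \<in> carrier P \<Longrightarrow> generic_hom p \<in> carrier (U \<otimes>\<^sub>F T)"
  unfolding generic_hom_def tensor_product_def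
  by (auto intro!: imageI UT.basis_sum_formal generator_closed)

lemma coeff_generic_hom: "e \<in> E \<Longrightarrow> p \<in> carrier P \<Longrightarrow> coeff T generic_hom e p = C (Gen e p)"
  unfolding coeff_def generic_hom_def
  by (rule UT.coordinate_basis_sum) (auto intro: generator_closed)

lemma component_generic_hom:
  assumes "(Q, f) \<in> H" "p \<in> carrier P"
  shows "id_tensor F U Q (component Q f) (generic_hom p) = f p"
proof (rule tensor_eqI[OF H_poisson[OF assms(1)]])
  note hom = component_hom[OF assms(1)]
  show "id_tensor F U Q (component Q f) (generic_hom p) \<in> carrier (U \<otimes>\<^sub>F Q)"
    by (rule poisson_homD(3)[OF id_tensor_poisson_hom[OF U.poisson_algebra_axioms
            poisson_algebra_T H_poisson[OF assms(1)] hom] generic_hom_closed[OF assms(2)]])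
  show "f p \<in> carrier (U \<otimes>\<^sub>F Q)" by (rule poisson_homD(3)[OF H_hom[OF assms(1)] assms(2)])
  fix e assume e: "e \<in> E"
  have "coordinate c Q e (id_tensor F U Q (component Q f) (generic_hom p)) =
      component Q f (coeff T generic_hom e p)"
    unfolding coeff_def[of T]
    by (rule coordinate_id_tensor[OF poisson_algebra_T H_poisson[OF assms(1)] hom
          generic_hom_closed[OF assms(2)] e])
  also have "\<dots> = coeff Q f e p"
  proof -
    have "(Q, coeff Q f) \<in> models" using assms(1) by (force simp: models_def)
    then show ?thesis using e assms(2) by (simp add: coeff_generic_hom representative_class(2))
  qed
  finally show "coordinate c Q e (id_tensor F U Q (component Q f) (generic_hom p)) =
      coordinate c Q e (f p)"
    by (simp add: coeff_def)
qed

text \<open>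
  The projections are jointly injective on the term algebra, and \<open>id \<otimes> \<pi>\<close> acts on a tensor by
  applying \<open>\<pi>\<close> to each coordinate.
\<close>

lemma tensor_joint:
  assumes X: "X \<in> carrier (U \<otimes>\<^sub>F T)" and Y: "Y \<in> carrier (U \<otimes>\<^sub>F T)"
    and eq: "\<And>Q f. (Q, f) \<in> H \<Longrightarrow>
      id_tensor F U Q (component Q f) X = id_tensor F U Q (component Q f) Y"
  shows "X = Y"
proof (rule tensor_eqI[OF poisson_algebra_T X Y])
  fix e assume e: "e \<in> E"
  have closed: "coordinate c T e Z \<in> carrier T" if "Z \<in> carrier (U \<otimes>\<^sub>F T)" for Z
    using that e UT.coordinate_closed by (simp add: tensor_product_def)
  show "coordinate c T e X = coordinate c T e Y"
  proof (rule proj_joint[OF closed[OF X] closed[OF Y]])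
    fix Q v assume "(Q, v) \<in> models"
    then obtain f where f: "(Q, f) \<in> H" "v = coeff Q f" by (auto simp: models_def)
    note * = coordinate_id_tensor[OF poisson_algebra_T H_poisson[OF f(1)] component_hom[OF f(1)] _ e]
    show "proj Q v (coordinate c T e X) = proj Q v (coordinate c T e Y)"
      using *[OF X] *[OF Y] eq[OF f(1)] f(2) by simp
  qed
qed

text \<open>
  By \<open>tensor_joint\<close> each identity can be checked after applying the homomorphisms \<open>id \<otimes> \<pi>\<close>. They
  take \<^term>\<open>generic_hom\<close> to the members of \<open>H\<close>, which are homomorphisms by assumption.
\<close>

lemma generic_hom_hom: "generic_hom \<in> poisson_hom F P (U \<otimes>\<^sub>F T)"
proof -
  note gc = generic_hom_closed
  note tc = tensor_product_closed[OF U.poisson_algebra_axioms poisson_algebra_T]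
  note idc = id_tensor_poisson_hom[OF U.poisson_algebra_axioms poisson_algebra_T
      H_poisson component_hom]
  show ?thesis
  proof (rule poisson_homI, goal_cases)
    case (1 p)
    then show ?case by (rule gc)
  next
    case (2 p q)
    then show ?case
      by (intro tensor_joint) (simp_all add: gc tc component_generic_hom
          poisson_homD(4)[OF idc] poisson_homD(4)[OF H_hom])
  next
    case (3 p q)
    then show ?case
      by (intro tensor_joint) (simp_all add: gc tc component_generic_hom
          poisson_homD(5)[OF idc] poisson_homD(5)[OF H_hom])
  next
    case (4 p q)
    then show ?case
      by (intro tensor_joint) (simp_all add: gc tc component_generic_hom P.bracket_closed
          poisson_homD(6)[OF idc] poisson_homD(6)[OF H_hom])
  next
    case (5 a p)
    then show ?case
      by (intro tensor_joint) (simp_all add: gc tc component_generic_hom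
          poisson_homD(7)[OF idc] poisson_homD(7)[OF H_hom])
  next
    case 6
    show ?case
      by (intro tensor_joint) (simp_all add: gc tc component_generic_hom
          poisson_homD(8)[OF idc] poisson_homD(8)[OF H_hom])
  qed
qed

end

context hom_problem
begin

lemma id_tensor_closed:
  assumes "poisson_algebra F V" "poisson_algebra F W" "g \<in> poisson_hom F V W"
    "X \<in> carrier (U \<otimes>\<^sub>F V)"
  shows "id_tensor F U W g X \<in> carrier (U \<otimes>\<^sub>F W)"
  by (rule poisson_homD(3)[OF id_tensor_poisson_hom[OF U.poisson_algebra_axioms assms(1-3)] assms(4)])

lemma coordinate_closed:
  assumes "poisson_algebra F V" "X \<in> carrier (U \<otimes>\<^sub>F V)" "e \<in> E"
  shows "coordinate c V e X \<in> carrier V"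
proof -
  interpret tensor_coordinates F U V E c using assms(1) by (rule tensor_coordinatesI)
  show ?thesis using assms(2,3) coordinate_closed by (simp add: tensor_product_def)
qed

lemma id_tensor_cong:
  assumes V: "poisson_algebra F V" and W: "poisson_algebra F W"
    and g: "g \<in> poisson_hom F V W" and h: "h \<in> poisson_hom F V W"
    and X: "X \<in> carrier (U \<otimes>\<^sub>F V)" and eq: "\<And>v. v \<in> carrier V \<Longrightarrow> g v = h v"
  shows "id_tensor F U W g X = id_tensor F U W h X"
  by (rule tensor_eqI[OF W id_tensor_closed[OF V W g X] id_tensor_closed[OF V W h X]])
    (simp add: coordinate_id_tensor[OF V W g X] coordinate_id_tensor[OF V W h X]
      eq coordinate_closed[OF V X])

lemma id_tensor_compose:
  assumes V: "poisson_algebra F V" and W: "poisson_algebra F W" and Q: "poisson_algebra F Q"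
    and g: "g \<in> poisson_hom F V W" and h: "h \<in> poisson_hom F W Q"
    and X: "X \<in> carrier (U \<otimes>\<^sub>F V)"
  shows "id_tensor F U Q (\<lambda>v. h (g v)) X = id_tensor F U Q h (id_tensor F U W g X)"
proof -
  note gX = id_tensor_closed[OF V W g X] and hg = poisson_hom_compose[OF g h]
  show ?thesis
    by (rule tensor_eqI[OF Q id_tensor_closed[OF V Q hg X] id_tensor_closed[OF W Q h gX]])
      (simp add: coordinate_id_tensor[OF V Q hg X] coordinate_id_tensor[OF W Q h gX]
        coordinate_id_tensor[OF V W g X])
qed

lemma id_tensor_ident:
  assumes V: "poisson_algebra F V" and X: "X \<in> carrier (U \<otimes>\<^sub>F V)"
  shows "id_tensor F U V (\<lambda>v. v) X = X"
proof -
  have id: "(\<lambda>v. v) \<in> poisson_hom F V V" by (rule poisson_homI) simp_all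
  show ?thesis
    by (rule tensor_eqI[OF V id_tensor_closed[OF V V id X] X])
      (simp add: coordinate_id_tensor[OF V V id X])
qed

definition generated_by_coeffs ::
  "('f, 'b) poisson \<Rightarrow> ('p \<Rightarrow> ('u \<times> 'b) multiset set) \<Rightarrow> bool" where
  "generated_by_coeffs B \<psi> \<longleftrightarrow>
     carrier B \<subseteq> term_value B (coeff B \<psi>) ` Collect (wf_term (carrier F) E (carrier P))"

text \<open>
  Both maps send the coefficients of \<open>\<psi>\<close> to those of \<open>f\<close>, and the coefficients of \<open>\<psi>\<close> generate \<open>B\<close>.
\<close>

lemma hom_unique:
  assumes B: "poisson_algebra F B" and \<psi>: "\<psi> \<in> poisson_hom F P (U \<otimes>\<^sub>F B)"
    and gen: "generated_by_coeffs B \<psi>" and Q: "poisson_algebra F Q"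
    and g: "g \<in> poisson_hom F B Q" "\<And>p. p \<in> carrier P \<Longrightarrow> id_tensor F U Q g (\<psi> p) = f p"
    and h: "h \<in> poisson_hom F B Q" "\<And>p. p \<in> carrier P \<Longrightarrow> id_tensor F U Q h (\<psi> p) = f p"
    and b: "b \<in> carrier B"
  shows "g b = h b"
proof -
  obtain t where t: "wf_term (carrier F) E (carrier P) t" "b = term_value B (coeff B \<psi>) t"
    using gen b by (auto simp: generated_by_coeffs_def)
  have "k b = term_value Q (coeff Q f) t"
    if k: "k \<in> poisson_hom F B Q" "\<And>p. p \<in> carrier P \<Longrightarrow> id_tensor F U Q k (\<psi> p) = f p" for k
  proof -
    have "k b = term_value Q (\<lambda>e p. k (coeff B \<psi> e p)) t"
      unfolding t(2) by (rule hom_term_value[OF B k(1) coeff_closed[OF B \<psi>] t(1)])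
    also have "\<dots> = term_value Q (coeff Q f) t"
      by (rule term_value_cong[OF _ t(1)]) (rule coeff_id_tensor[OF B \<psi> Q k, symmetric])
    finally show ?thesis .
  qed
  with g h show ?thesis by metis
qed

lemma universalI:
  fixes B :: "('f, 'b) poisson"
  assumes B: "poisson_algebra F B" and \<psi>: "\<psi> \<in> poisson_hom F P (U \<otimes>\<^sub>F B)"
    and gen: "generated_by_coeffs B \<psi>"
    and ex: "\<And>(Q :: ('f, 'q) poisson) f. poisson_algebra F Q \<Longrightarrow> f \<in> poisson_hom F P (U \<otimes>\<^sub>F Q) \<Longrightarrow>
      \<exists>g\<in>poisson_hom F B Q. \<forall>p\<in>carrier P. id_tensor F U Q g (\<psi> p) = f p"
  shows "universal_poisson_algebra_for TYPE('q) F P U B \<psi>"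
  unfolding universal_poisson_algebra_for_def
proof (intro conjI allI impI B \<psi>)
  fix Q :: "('f, 'q) poisson" and f
  assume Q: "poisson_algebra F Q" and f: "f \<in> poisson_hom F P (U \<otimes>\<^sub>F Q)"
  obtain g where g: "g \<in> poisson_hom F B Q" "\<And>p. p \<in> carrier P \<Longrightarrow> id_tensor F U Q g (\<psi> p) = f p"
    using ex[OF Q f] by blast
  have r: "restrict g (carrier B) \<in> poisson_hom F B Q"
    by (rule poisson_hom_cong[OF B g(1)]) simp
  show "\<exists>!g. g \<in> poisson_hom F B Q \<and> g \<in> extensional (carrier B) \<and>
      (\<forall>p\<in>carrier P. id_tensor F U Q g (\<psi> p) = f p)"
  proof (intro ex1I[of _ "restrict g (carrier B)"] conjI ballI r restrict_extensional)
    fix p assume p: "p \<in> carrier P"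
    have "id_tensor F U Q (restrict g (carrier B)) (\<psi> p) = id_tensor F U Q g (\<psi> p)"
      by (rule id_tensor_cong[OF B Q r g(1) poisson_homD(3)[OF \<psi> p]]) simp
    then show "id_tensor F U Q (restrict g (carrier B)) (\<psi> p) = f p" using g(2)[OF p] by simp
  next
    fix h assume h: "h \<in> poisson_hom F B Q \<and> h \<in> extensional (carrier B) \<and>
      (\<forall>p\<in>carrier P. id_tensor F U Q h (\<psi> p) = f p)"
    show "h = restrict g (carrier B)"
    proof (rule extensionalityI[of _ "carrier B"])
      show "h b = restrict g (carrier B) b" if "b \<in> carrier B" for b
        using hom_unique[OF B \<psi> gen Q, of h f g b] h g that by simp
    qed (use h in auto)
  qed
qed

end

lemma universalD:
  fixes Q :: "('f, 'q) poisson"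
  assumes "universal_poisson_algebra_for TYPE('q) F P U B \<psi>"
    and "poisson_algebra F Q" "f \<in> poisson_hom F P (tensor_product F U Q)"
  shows "\<exists>!g. g \<in> poisson_hom F B Q \<and> g \<in> extensional (carrier B) \<and>
    (\<forall>p\<in>carrier P. id_tensor F U Q g (\<psi> p) = f p)"
  using assms unfolding universal_poisson_algebra_for_def by simp

lemma (in hom_family) generic_hom_generated: "generated_by_coeffs T generic_hom"
proof -
  have "X \<in> term_value T (coeff T generic_hom) ` Collect wf" if X: "X \<in> carrier T" for X
  proof -
    obtain t where t: "wf t" "X = C t" using X by (auto simp: T_carrier)
    have "X = term_value T (coeff T generic_hom) t"
      unfolding t(2) C_eq_term_value[OF t(1)]
      by (rule term_value_cong[OF _ t(1)]) (simp add: coeff_generic_hom)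
    then show ?thesis using t(1) by blast
  qed
  then show ?thesis by (auto simp: generated_by_coeffs_def)
qed

context hom_problem
begin

lemma hom_familyI:
  assumes "\<And>Q f. (Q, f) \<in> H \<Longrightarrow> poisson_algebra F Q"
    and "\<And>Q f. (Q, f) \<in> H \<Longrightarrow> f \<in> poisson_hom F P (U \<otimes>\<^sub>F Q)"
  shows "hom_family F P U E c H"
  by (intro hom_family.intro hom_problem_axioms hom_family_axioms.intro) (fact assms)+

lemma universal_exists: "\<exists>B \<psi>. universal_poisson_algebra F P U B \<psi>"
proof -
  define H :: "(('f, ('f, 'p, 'u) poisson_term set) poisson \<times> _) set"
    where "H = {(Q, f). poisson_algebra F Q \<and> f \<in> poisson_hom F P (U \<otimes>\<^sub>F Q)}"
  interpret hom_family F P U E c H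
    by (rule hom_familyI) (simp_all add: H_def)
  have "universal_poisson_algebra F P U T generic_hom"
  proof (rule universalI[OF poisson_algebra_T generic_hom_hom generic_hom_generated])
    fix Q :: "('f, ('f, 'p, 'u) poisson_term set) poisson" and f
    assume "poisson_algebra F Q" "f \<in> poisson_hom F P (U \<otimes>\<^sub>F Q)"
    then have "(Q, f) \<in> H" by (simp add: H_def)
    then show "\<exists>g\<in>poisson_hom F T Q. \<forall>p\<in>carrier P. id_tensor F U Q g (generic_hom p) = f p"
      using component_hom component_generic_hom by blast
  qed
  then show ?thesis by blast
qed

text \<open>
  For the one-element family \<open>{(Q, f)}\<close> the generic homomorphism maps to \<open>U \<otimes> T\<close> with \<open>T\<close> an algebra of
  sets of terms, so it factors through \<open>\<psi>\<close>. Projecting \<open>T\<close> to \<open>Q\<close> gives a factorisation of \<open>f\<close>. It takes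
  values in the subalgebra generated by the coefficients of \<open>f\<close>, because the projection does.
\<close>

lemma universal_lift:
  fixes Q :: "('f, 'q) poisson"
  assumes univ: "universal_poisson_algebra F P U B \<psi>"
    and Q: "poisson_algebra F Q" and f: "f \<in> poisson_hom F P (U \<otimes>\<^sub>F Q)"
  shows "\<exists>g\<in>poisson_hom F B Q. (\<forall>b\<in>carrier B. g b \<in>
        term_value Q (coeff Q f) ` Collect (wf_term (carrier F) E (carrier P))) \<and>
      (\<forall>p\<in>carrier P. id_tensor F U Q g (\<psi> p) = f p)"
proof -
  have B: "poisson_algebra F B" and \<psi>: "\<psi> \<in> poisson_hom F P (U \<otimes>\<^sub>F B)"
    using univ by (simp_all add: universal_poisson_algebra_for_def)
  interpret hom_family F P U E c "{(Q, f)}"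
    by (rule hom_familyI) (use Q f in simp_all)
  obtain g where g: "g \<in> poisson_hom F B T"
    "\<And>p. p \<in> carrier P \<Longrightarrow> id_tensor F U T g (\<psi> p) = generic_hom p"
    using ex1_implies_ex[OF universalD[OF univ poisson_algebra_T generic_hom_hom]] by (elim exE conjE) metis
  have k: "component Q f \<in> poisson_hom F T Q" by (rule component_hom) simp
  have "id_tensor F U Q (\<lambda>b. component Q f (g b)) (\<psi> p) = f p" if p: "p \<in> carrier P" for p
    using id_tensor_compose[OF B poisson_algebra_T Q g(1) k poisson_homD(3)[OF \<psi> p]]
    by (simp add: g(2)[OF p] component_generic_hom p)
  moreover have "component Q f (g b) \<in> term_value Q (coeff Q f) ` Collect wf"
    if "b \<in> carrier B" for b
    using representative_wf[OF poisson_homD(3)[OF g(1) that]] by blast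
  ultimately show ?thesis
    using poisson_hom_compose[OF g(1) k] by (intro bexI[of _ "\<lambda>b. component Q f (g b)"]) auto
qed

text \<open>
  Lifting \<open>\<psi>\<close> along itself gives an endomorphism \<open>h\<close> of \<open>B\<close> with values in the subalgebra
  generated by the coefficients of \<open>\<psi>\<close>. The identity is another solution of the same problem, so \<open>h\<close>
  is the identity and that subalgebra is all of \<open>B\<close>.
\<close>

lemma universal_any_type:
  assumes univ: "universal_poisson_algebra F P U B \<psi>"
  shows "universal_poisson_algebra_for TYPE('q) F P U B \<psi>"
proof -
  have B: "poisson_algebra F B" and \<psi>: "\<psi> \<in> poisson_hom F P (U \<otimes>\<^sub>F B)"
    using univ by (simp_all add: universal_poisson_algebra_for_def)
  note lift = universal_lift[OF univ]
  have "generated_by_coeffs B \<psi>"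
  proof -
    obtain h where h: "h \<in> poisson_hom F B B"
      "\<And>p. p \<in> carrier P \<Longrightarrow> id_tensor F U B h (\<psi> p) = \<psi> p"
      "\<And>b. b \<in> carrier B \<Longrightarrow> h b \<in>
        term_value B (coeff B \<psi>) ` Collect (wf_term (carrier F) E (carrier P))"
      using lift[OF B \<psi>] by blast
    have id: "(\<lambda>b. b) \<in> poisson_hom F B B" by (rule poisson_homI) simp_all
    have r: "restrict k (carrier B) \<in> poisson_hom F B B \<and>
        restrict k (carrier B) \<in> extensional (carrier B) \<and>
        (\<forall>p\<in>carrier P. id_tensor F U B (restrict k (carrier B)) (\<psi> p) = \<psi> p)"
      if k: "k \<in> poisson_hom F B B" "\<And>p. p \<in> carrier P \<Longrightarrow> id_tensor F U B k (\<psi> p) = \<psi> p" for k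
    proof -
      have r: "restrict k (carrier B) \<in> poisson_hom F B B"
        by (rule poisson_hom_cong[OF B k(1)]) simp
      have "id_tensor F U B (restrict k (carrier B)) (\<psi> p) = \<psi> p" if p: "p \<in> carrier P" for p
        using id_tensor_cong[OF B B r k(1) poisson_homD(3)[OF \<psi> p]] k(2)[OF p] by simp
      with r show ?thesis by simp
    qed
    have "\<exists>!g. g \<in> poisson_hom F B B \<and> g \<in> extensional (carrier B) \<and>
        (\<forall>p\<in>carrier P. id_tensor F U B g (\<psi> p) = \<psi> p)"
      by (rule universalD[OF univ B \<psi>])
    then have "restrict h (carrier B) = restrict (\<lambda>b. b) (carrier B)"
      using r[OF h(1,2)] r[OF id id_tensor_ident[OF B poisson_homD(3)[OF \<psi>]]] by blast
    then have "h b = b" if "b \<in> carrier B" for b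
      using that by (metis restrict_apply')
    then show ?thesis
      using h(3) unfolding generated_by_coeffs_def by (metis subsetI)
  qed
  then show ?thesis
    using lift by (intro universalI[OF B \<psi>]) blast+
qed

end

theorem theorem3p2:
  fixes F :: "'f ring" and P :: "('f, 'p) poisson" and U :: "('f, 'u) poisson"
  assumes "field F" and "poisson_algebra F P" and "poisson_algebra F U"
    and "vectorspace.fin_dim F U"
  shows "(\<exists>B \<psi>. universal_poisson_algebra F P U B \<psi>) \<and>
    (\<forall>B \<psi>. universal_poisson_algebra F P U B \<psi> \<longrightarrow>
       universal_poisson_algebra_for TYPE('q) F P U B \<psi>)"
proof -
  interpret P: poisson_algebra F P by fact
  interpret U: poisson_algebra F U by fact
  interpret F: field F by fact
  have "vectorspace F U" ..
  then obtain E c where "coordinates F U E c"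
    using coordinates_exist assms(4) by blast
  then interpret coordinates F U E c .
  interpret hom_problem F P U E c ..
  show ?thesis using universal_exists universal_any_type by blast
qed

end
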